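(* Let $k=1$, let $h\in C([0,\infty);\mathbb{R})$ be fixed, let $z_0=(u_0,\rho_0)\in H^s\times H^{s-1}$ with $s\ge2$, and let $T$ be the maximal existence time of the corresponding solution $z=(u,\rho)$ to the system (HS) with initial data $z_0$. Suppose that $\rho_0\not\equiv0$ or $u_0\not\equiv c$ for any $c\in\mathbb{R}$ (i.e. $\rho_0$ is not identically zero or $u_0$ is not constant), and that there exists a point $x_0\in\mathbb{S}$ such that $\rho_0(x_0)=0$. Then the solution blows up in finite time.
   Context: Notation: $\mathbb{S}=\mathbb{R}/\mathbb{Z}$, $H^r=H^r(\mathbb{S})$; functions on $\mathbb{S}$ are identified with 1-periodic functions on $\mathbb{R}$; $\partial_x^{-1}g(x)=\int_0^x g(y)\,dy$. For $k\in\{1,-1\}$, the periodic two-component Hunter-Saxton system is $u_{txx}+2u_xu_{xx}+uu_{xxx}-k\rho\rho_x=0$, $\rho_t+(\rho u)_x=0$, with 1-periodic $u,\rho$ and initial data $(u_0,\rho_0)$. Its solutions are understood through the following integrated form, with an arbitrary but fixed $h\in C([0,\infty);\mathbb{R})$, called (HS): $$\begin{cases} u_t+uu_x=\partial_x^{-1}\left(\frac k2\rho^2+\frac12u_x^2+a\right)+h(t), & t>0,\ x\in\mathbb{R},\\ \rho_t+(\rho u)_x=0, & t>0,\ x\in\mathbb{R},\\ u(0,x)=u_0(x),\ \rho(0,x)=\rho_0(x), & x\in\mathbb{R},\\ u(t,x+1)=u(t,x),\ \rho(t,x+1)=\rho(t,x), & t\ge0,\ x\in\mathbb{R},\end{cases}$$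 where $a=-\frac12\int_{\mathbb{S}}(k\rho_0^2+u_{0,x}^2)\,dx$. Known local well-posedness (used to define $T$): for $h\in C([0,\infty);\mathbb{R})$ and $z_0=(u_0,\rho_0)\in H^s\times H^{s-1}$ with $s\ge2$, there exist a maximal existence time $T\in(0,\infty]$ and a unique solution $z=(u,\rho)$ of (HS) with $z\in C([0,T);H^s\times H^{s-1})\cap C^1([0,T);H^{s-1}\times H^{s-2})$. The solution is said to blow up in finite time if $T<\infty$. *)

theory Defs
  imports "HOL-Analysis.Analysis"
begin

text \<open>
  Functions on the circle \<open>\<real>/\<int>\<close> are 1-periodic functions on the real line; points of the
  circle are represented by real numbers.
\<close>

definition periodic1 :: "(real \<Rightarrow> real) \<Rightarrow> bool" where
  "periodic1 g \<longleftrightarrow> (\<forall>x. g (x + 1) = g x)"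

definition fourier_coeff :: "(real \<Rightarrow> real) \<Rightarrow> int \<Rightarrow> complex" where
  "fourier_coeff g n =
     (LINT x:{0..1}|lborel. complex_of_real (g x) * cis (- (2 * pi * of_int n * x)))"

definition sobolev_term :: "real \<Rightarrow> (real \<Rightarrow> real) \<Rightarrow> int \<Rightarrow> real" where
  "sobolev_term r g n =
     (1 + (2 * pi * of_int n)\<^sup>2) powr r * (cmod (fourier_coeff g n))\<^sup>2"

text \<open>
  \<open>H\<^sup>r(\<real>/\<int>)\<close> for \<open>r \<ge> 0\<close>, as a set of representatives.  For \<open>r > 1/2\<close> every class has a unique
  continuous representative, and an element of \<open>H\<^sup>r\<close> is identified with it; without that clause
  pointwise conditions would be meaningless.  For \<open>r \<le> 1/2\<close> functions in the set are only
  relevant up to null sets.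
\<close>

definition sobolev :: "real \<Rightarrow> (real \<Rightarrow> real) set" where
  "sobolev r = {g. periodic1 g \<and> g \<in> borel_measurable borel
      \<and> set_integrable lborel {0..1} (\<lambda>x. (g x)\<^sup>2)
      \<and> sobolev_term r g summable_on UNIV
      \<and> (r > 1/2 \<longrightarrow> continuous_on UNIV g)}"

definition sobolev_norm :: "real \<Rightarrow> (real \<Rightarrow> real) \<Rightarrow> real" where
  "sobolev_norm r g = sqrt (\<Sum>\<^sub>\<infinity>n\<in>UNIV. sobolev_term r g n)"

text \<open>\<open>C(I; H\<^sup>r)\<close>; a curve is given by its values \<open>f t x\<close>, those for \<open>t \<notin> I\<close> being irrelevant.\<close>

definition sobolev_C0 :: "real set \<Rightarrow> real \<Rightarrow> (real \<Rightarrow> real \<Rightarrow> real) \<Rightarrow> bool" where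
  "sobolev_C0 I r f \<longleftrightarrow> (\<forall>t\<in>I. f t \<in> sobolev r) \<and>
     (\<forall>t\<in>I. ((\<lambda>\<tau>. sobolev_norm r (\<lambda>x. f \<tau> x - f t x)) \<longlongrightarrow> 0) (at t within I))"

text \<open>\<open>f \<in> C\<^sup>1(I; H\<^sup>r)\<close> with derivative \<open>f'\<close> (one-sided at an endpoint belonging to \<open>I\<close>).\<close>

definition sobolev_C1 ::
  "real set \<Rightarrow> real \<Rightarrow> (real \<Rightarrow> real \<Rightarrow> real) \<Rightarrow> (real \<Rightarrow> real \<Rightarrow> real) \<Rightarrow> bool" where
  "sobolev_C1 I r f f' \<longleftrightarrow> sobolev_C0 I r f \<and> sobolev_C0 I r f' \<and>
     (\<forall>t\<in>I. ((\<lambda>\<tau>. sobolev_norm r (\<lambda>x. (f \<tau> x - f t x) / (\<tau> - t) - f' t x)) \<longlongrightarrow> 0)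
              (at t within I))"

definition test_function :: "(real \<Rightarrow> real) \<Rightarrow> bool" where
  "test_function \<phi> \<longleftrightarrow> periodic1 \<phi> \<and> (\<forall>n x. (deriv ^^ n) \<phi> differentiable (at x))"

text \<open>\<open>f\<^sub>x = g\<close> in the sense of distributions on the circle; this determines \<open>g\<close> almost everywhere.\<close>

definition weak_deriv :: "(real \<Rightarrow> real) \<Rightarrow> (real \<Rightarrow> real) \<Rightarrow> bool" where
  "weak_deriv f g \<longleftrightarrow> periodic1 f \<and> periodic1 g
     \<and> set_integrable lborel {0..1} f \<and> set_integrable lborel {0..1} g
     \<and> (\<forall>\<phi>. test_function \<phi> \<longrightarrow>
          (LINT x:{0..1}|lborel. f x * deriv \<phi> x) = - (LINT x:{0..1}|lborel. g x * \<phi> x))"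

text \<open>The interval integral is oriented, so this is also the right thing for \<open>x < 0\<close>.\<close>

definition inv_dx :: "(real \<Rightarrow> real) \<Rightarrow> real \<Rightarrow> real" where
  "inv_dx g x = (LBINT y=0..x. g y)"

definition hs_const :: "real \<Rightarrow> (real \<Rightarrow> real) \<Rightarrow> (real \<Rightarrow> real) \<Rightarrow> real" where
  "hs_const k u0 \<rho>0 =
     - (1/2) * (LINT x:{0..1}|lborel. k * (\<rho>0 x)\<^sup>2 + (deriv u0 x)\<^sup>2)"

definition time_interval :: "ereal \<Rightarrow> real set" where
  "time_interval T = {t. 0 \<le> t \<and> ereal t < T}"

text \<open>
  \<open>(u, \<rho>)\<close> is a solution of the integrated system on \<open>[0,T)\<close> in
  \<open>C([0,T); H\<^sup>s \<times> H\<^sup>s\<^sup>-\<^sup>1) \<inter> C\<^sup>1([0,T); H\<^sup>s\<^sup>-\<^sup>1 \<times> H\<^sup>s\<^sup>-\<^sup>2)\<close>, \<open>s \<ge> 2\<close>; the time derivatives \<open>u\<^sub>t\<close>, \<open>\<rho>\<^sub>t\<close> are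
  those of the curves with values in \<open>H\<^sup>s\<^sup>-\<^sup>1\<close> and \<open>H\<^sup>s\<^sup>-\<^sup>2\<close>.  As \<open>u t\<close> lies in \<open>H\<^sup>2\<close>, hence is \<open>C\<^sup>1\<close>,
  its spatial derivative is the classical one, and all terms of the first equation are
  continuous in \<open>x\<close>, so that it can be read pointwise.  The product \<open>\<rho> u\<close> is in general only in \<open>H\<^sup>1\<close>,
  so the second equation is one between \<open>L\<^sup>2\<close> functions, with \<open>(\<rho> u)\<^sub>x\<close> a weak derivative.
  Periodicity in \<open>x\<close> is part of membership in the Sobolev spaces.
\<close>

definition hs_solution ::
  "real \<Rightarrow> (real \<Rightarrow> real) \<Rightarrow> real \<Rightarrow> (real \<Rightarrow> real) \<Rightarrow> (real \<Rightarrow> real) \<Rightarrow> ereal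
    \<Rightarrow> (real \<Rightarrow> real \<Rightarrow> real) \<Rightarrow> (real \<Rightarrow> real \<Rightarrow> real) \<Rightarrow> bool" where
  "hs_solution k h s u0 \<rho>0 T u \<rho> \<longleftrightarrow> 0 < T
     \<and> sobolev_C0 (time_interval T) s u
     \<and> sobolev_C0 (time_interval T) (s - 1) \<rho>
     \<and> (\<forall>x. u 0 x = u0 x) \<and> (\<forall>x. \<rho> 0 x = \<rho>0 x)
     \<and> (\<exists>ut \<rho>t.
          sobolev_C1 (time_interval T) (s - 1) u ut
        \<and> sobolev_C1 (time_interval T) (s - 2) \<rho> \<rho>t
        \<and> (\<forall>t\<in>time_interval T. t > 0 \<longrightarrow>
             (\<forall>x. ut t x + u t x * deriv (u t) x
                = inv_dx (\<lambda>y. k / 2 * (\<rho> t y)\<^sup>2 + 1 / 2 * (deriv (u t) y)\<^sup>2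
                              + hs_const k u0 \<rho>0) x + h t))
        \<and> (\<forall>t\<in>time_interval T. t > 0 \<longrightarrow>
             (\<exists>q. weak_deriv (\<lambda>x. \<rho> t x * u t x) q
                \<and> (AE x in lborel. \<rho>t t x + q x = 0))))"

text \<open>
  \<open>T\<close> is the maximal existence time of the solution \<open>(u, \<rho>)\<close>: the solution lives on \<open>[0,T)\<close> and
  is not the restriction of a solution on a longer interval.
\<close>

definition hs_maximal_solution ::
  "real \<Rightarrow> (real \<Rightarrow> real) \<Rightarrow> real \<Rightarrow> (real \<Rightarrow> real) \<Rightarrow> (real \<Rightarrow> real) \<Rightarrow> ereal
    \<Rightarrow> (real \<Rightarrow> real \<Rightarrow> real) \<Rightarrow> (real \<Rightarrow> real \<Rightarrow> real) \<Rightarrow> bool" where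
  "hs_maximal_solution k h s u0 \<rho>0 T u \<rho> \<longleftrightarrow> hs_solution k h s u0 \<rho>0 T u \<rho>
     \<and> \<not> (\<exists>T' u' \<rho>'. T < T' \<and> hs_solution k h s u0 \<rho>0 T' u' \<rho>'
            \<and> (\<forall>t\<in>time_interval T. u' t = u t \<and> \<rho>' t = \<rho> t))"

end

theory Submission
  imports Defs
begin

text \<open>
  Write \<open>v = u\<^sub>x\<close>.  Differentiating the first equation in \<open>x\<close> gives, along a characteristic
  \<open>\<phi>' = u(t, \<phi>)\<close>, the equation \<open>v' = \<rho>\<^sup>2 / 2 - v\<^sup>2 / 2 + a\<close>, and the second equation gives
  \<open>\<rho>' = - v \<rho>\<close>.  If the characteristic starts at a zero of \<open>\<rho>\<^sub>0\<close>, then \<open>\<rho>\<close> stays zero on it, and there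
  \<open>v' = a - v\<^sup>2 / 2\<close>.  The constant \<open>a\<close> is negative because the initial data are nontrivial.
  Hence \<open>v\<close> tends to \<open>-\<infinity>\<close> within time \<open>2\<pi> / \<surd>(-2a)\<close>, while a global solution would keep \<open>v\<close> finite.

  Two points need care at the regularity \<open>H\<^sup>2 \<times> H\<^sup>1\<close>.  First, the solution is described by Fourier
  coefficients and Sobolev norms, whereas the argument is pointwise.  Uniqueness of Fourier coefficients
  (\<open>fourier_uniqueness\<close>) and the embeddings \<open>sobolev_sup_bound\<close> and \<open>sobolev_imp_C1\<close> show that \<open>u\<close>, \<open>v\<close> and
  \<open>\<rho>\<close> are jointly continuous and that \<open>u\<^sub>t\<close> exists pointwise.  The second equation, an identity between
  square integrable functions, becomes classical for the antiderivative of \<open>\<rho>\<close>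
  (\<open>density_potential_derivative\<close>).  Secondly, neither \<open>v\<close> nor \<open>\<rho>\<close> need be differentiable in \<open>x\<close>, so that
  the equations along characteristics cannot be obtained by the chain rule;
  \<open>transport_along_characteristic\<close> derives them from the potentials \<open>u\<close> and \<open>\<integral>\<rho>\<close>, by averaging over a small
  moving window.  The characteristic itself comes from \<open>picard_lindelof_strip\<close>, and \<open>riccati_blowup\<close> is the
  final contradiction.
\<close>

section \<open>Uniqueness of Fourier coefficients\<close>

text \<open>
  The coefficients of complex-valued functions are needed because products with characters and the sums of
  Fourier series are complex.  A gauge integral suffices, as only continuous functions occur.
\<close>
definition cfourier :: "(real \<Rightarrow> complex) \<Rightarrow> int \<Rightarrow> complex" where
  "cfourier f n = integral {0..1} (\<lambda>x. f x * cis (- (2 * pi * of_int n * x)))"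

text \<open>
  The weights \<open>w\<close> for which all Fourier coefficients of \<open>f w\<close> vanish form a module over the ring of
  polynomials in the real and imaginary part of \<open>e\<^sup>2\<^sup>\<pi>\<^sup>i\<^sup>x\<close>: multiplication by a linear form on the
  circle only shifts the index \<open>n\<close> by \<open>\<plusminus>1\<close>.  Generalising over \<open>w\<close> lets products be treated by
  two successive applications, without expanding a polynomial into characters.
\<close>
lemma trig_polynomial_orthogonal:
  fixes f w :: "real \<Rightarrow> complex"
  assumes p: "real_polynomial_function p"
    and f: "continuous_on {0..1} f"
    and w: "continuous_on {0..1} w" "\<And>n. cfourier (\<lambda>x. f x * w x) n = 0"
  shows "continuous_on {0..1} (\<lambda>x. of_real (p (cis (2 * pi * x))) * w x) \<and>
         (\<forall>n. cfourier (\<lambda>x. f x * (of_real (p (cis (2 * pi * x))) * w x)) n = 0)"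
  using p w
proof (induction p arbitrary: w rule: real_polynomial_function.induct)
  case (linear p)
  note w = linear.prems
  interpret bounded_linear p by fact
  obtain \<alpha> \<beta> where pz: "\<And>z. p z = Re z * \<alpha> + Im z * \<beta>"
  proof
    fix z
    have "z = Re z *\<^sub>R 1 + Im z *\<^sub>R \<i>" by (simp add: complex_eq_iff)
    then have "p z = p (Re z *\<^sub>R 1 + Im z *\<^sub>R \<i>)" by (rule arg_cong)
    then show "p z = Re z * p 1 + Im z * p \<i>" by (simp only: add scaleR real_scaleR_def)
  qed
  have c: "continuous_on {0..1} (\<lambda>x. of_real (p (cis (2 * pi * x))) * w x)"
    unfolding pz by (intro continuous_intros w)
  have "cfourier (\<lambda>x. f x * (of_real (p (cis (2 * pi * x))) * w x)) n = 0" for n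
  proof -
    define A B where "A = (of_real \<alpha> - \<i> * of_real \<beta>) / 2"
      and "B = (of_real \<alpha> + \<i> * of_real \<beta>) / 2"
    have P: "of_real (p (cis \<theta>)) = A * cis \<theta> + B * cis (- \<theta>)" for \<theta>
      unfolding pz A_def B_def by (simp add: complex_eq_iff field_simps)
    have int: "(\<lambda>x. f x * w x * cis (- (2 * pi * of_int m * x))) integrable_on {0..1}" for m :: int
      by (intro integrable_continuous_real continuous_intros f w)
    have "f x * (of_real (p (cis (2 * pi * x))) * w x) * cis (- (2 * pi * of_int n * x)) =
       A * (f x * w x * cis (- (2 * pi * of_int (n - 1) * x)))
      + B * (f x * w x * cis (- (2 * pi * of_int (n + 1) * x)))" for x
    proof -
      have "cis (- (2 * pi * of_int (n - 1) * x)) = cis (2 * pi * x) * cis (- (2 * pi * of_int n * x))"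
        "cis (- (2 * pi * of_int (n + 1) * x)) = cis (- (2 * pi * x)) * cis (- (2 * pi * of_int n * x))"
        by (simp_all add: cis_mult algebra_simps)
      moreover have "a * ((A * c + B * c') * b) * d = A * (a * b * (c * d)) + B * (a * b * (c' * d))"
        for a b c c' d :: complex by (simp add: algebra_simps)
      ultimately show ?thesis unfolding P by (simp only:)
    qed
    then have "cfourier (\<lambda>x. f x * (of_real (p (cis (2 * pi * x))) * w x)) n =
        A * cfourier (\<lambda>x. f x * w x) (n - 1) + B * cfourier (\<lambda>x. f x * w x) (n + 1)"
      unfolding cfourier_def using int[of "n-1"] int[of "n+1"]
      by (simp only: integral_add integrable_on_mult_right integral_mult_right)
    then show ?thesis by (simp add: w)
  qed
  with c show ?case by blast
next
  case (const c)
  have "cfourier (\<lambda>x. f x * (of_real c * w x)) n = of_real c * cfourier (\<lambda>x. f x * w x) n" for n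
    unfolding cfourier_def integral_mult_right[symmetric] by (simp add: mult_ac)
  then show ?case using const by (auto intro!: continuous_intros)
next
  case (add p q)
  have i: "(\<lambda>x. f x * v x * cis (- (2 * pi * of_int n * x))) integrable_on {0..1}"
    if "continuous_on {0..1} v" for v n
    by (intro integrable_continuous_real continuous_intros f that)
  have "cfourier (\<lambda>x. f x * (of_real (p (cis (2 * pi * x)) + q (cis (2 * pi * x))) * w x)) n
     = cfourier (\<lambda>x. f x * (of_real (p (cis (2 * pi * x))) * w x)) n
     + cfourier (\<lambda>x. f x * (of_real (q (cis (2 * pi * x))) * w x)) n" for n
    unfolding cfourier_def
    using i[of "\<lambda>x. of_real (p (cis (2 * pi * x))) * w x" n] i[of "\<lambda>x. of_real (q (cis (2 * pi * x))) * w x" n]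
      add.IH[OF add.prems]
    by (subst integral_add[symmetric]) (auto simp: algebra_simps)
  then show ?case using add.IH[OF add.prems] 
    by (auto simp: distrib_right intro!: continuous_on_add)
next
  case (mult p q)
  have "continuous_on {0..1} (\<lambda>x. of_real (q (cis (2 * pi * x))) * w x)"
    "\<And>n. cfourier (\<lambda>x. f x * (of_real (q (cis (2 * pi * x))) * w x)) n = 0"
    using mult.IH(2)[OF mult.prems] by auto
  from mult.IH(1)[OF this] show ?case by (simp add: mult.assoc)
qed

text \<open>
  The map \<open>x \<mapsto> e\<^sup>2\<^sup>\<pi>\<^sup>i\<^sup>x\<close> from the compact interval onto the circle is closed, so a continuous function
  that takes equal values at both ends descends to a continuous function, even though the inverse branch
  given by the argument jumps.
\<close>
lemma periodic_factors_through_circle: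
  fixes g :: "real \<Rightarrow> real"
  assumes g: "continuous_on {0..1} g" "g 0 = g 1"
  obtains F where "continuous_on (sphere (0::complex) 1) F"
    "\<And>x. x \<in> {0..1} \<Longrightarrow> F (cis (2 * pi * x)) = g x"
proof -
  define F where "F z = g (Arg2pi z / (2 * pi))" for z
  have F: "F (cis (2 * pi * x)) = g x" if "x \<in> {0..1}" for x
  proof (cases "x = 1")
    case True
    have "Arg2pi 1 = 0" by (simp add: Arg2pi_eq_0)
    with True show ?thesis by (simp add: F_def g)
  next
    case False
    have "Arg2pi (cis (2 * pi * x)) = 2 * pi * x"
      by (rule Arg2pi_unique[of 1]) (use that False in \<open>auto simp: cis_conv_exp\<close>)
    then show ?thesis by (simp add: F_def)
  qed
  have "continuous_on (sphere 0 1) F"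
    unfolding continuous_on_closed_vimage[OF closed_sphere]
  proof safe
    fix C :: "real set" assume C: "closed C"
    have "F -` C \<inter> sphere 0 1 = (\<lambda>x. cis (2 * pi * x)) ` ({0..1} \<inter> g -` C)"
    proof safe
      fix z :: complex assume z: "F z \<in> C" "z \<in> sphere 0 1"
      define x where "x = Arg2pi z / (2 * pi)"
      have x: "x \<in> {0..1}" using Arg2pi[of z] by (auto simp: x_def)
      have "z = cis (2 * pi * x)" using Arg2pi_eq[of z] z by (simp add: x_def cis_conv_exp)
      then show "z \<in> (\<lambda>x. cis (2 * pi * x)) ` ({0..1} \<inter> g -` C)"
        using z x F[OF x] by auto
    qed (auto simp: F)
    moreover have "compact ((\<lambda>x. cis (2 * pi * x)) ` ({0..1} \<inter> g -` C))"
      using continuous_closed_preimage[OF g(1) _ C]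
      by (intro compact_continuous_image continuous_intros)
         (metis Int_lower1 bounded_closed_interval bounded_subset closed_atLeastAtMost compact_eq_bounded_closed)
    ultimately show "closed (F -` C \<inter> sphere 0 1)" by (simp add: compact_imp_closed)
  qed
  then show thesis using F by (rule that)
qed

text \<open>
  By Stone and Weierstrass on the circle, \<open>f\<close> is orthogonal to every continuous periodic real function,
  in particular to its own real and imaginary parts.
\<close>
theorem fourier_uniqueness:
  fixes f :: "real \<Rightarrow> complex"
  assumes f: "continuous_on {0..1} f" "f 0 = f 1" and z: "\<And>n. cfourier f n = 0" and x: "x \<in> {0..1}"
  shows "f x = 0"
proof -
  have orth: "integral {0..1} (\<lambda>x. f x * of_real (g x)) = 0"
    if g: "continuous_on {0..1} g" "g 0 = g 1" for g :: "real \<Rightarrow> real"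
  proof -
    obtain F where F: "continuous_on (sphere (0::complex) 1) F"
      "\<And>x. x \<in> {0..1} \<Longrightarrow> F (cis (2 * pi * x)) = g x"
      using periodic_factors_through_circle[OF g] by blast
    have "bounded (f ` {0..1})"
      by (intro compact_imp_bounded compact_continuous_image f compact_Icc)
    then obtain M where M: "\<And>x. x \<in> {0..1} \<Longrightarrow> norm (f x) \<le> M" "M > 0"
      unfolding bounded_pos by (meson imageI)
    have "norm (integral {0..1} (\<lambda>x. f x * of_real (g x))) \<le> e" if "e > 0" for e
    proof -
      obtain p where p: "real_polynomial_function p" "\<And>z. z \<in> sphere 0 1 \<Longrightarrow> \<bar>F z - p z\<bar> < e / M"
        using Stone_Weierstrass_real_polynomial_function[OF compact_sphere F(1), of "e / M"] M \<open>e > 0\<close>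
        by auto
      note pw = trig_polynomial_orthogonal[OF p(1) f(1), of "\<lambda>_. 1"]
      have pc: "continuous_on {0..1} (\<lambda>x. complex_of_real (p (cis (2 * pi * x))))"
        and p0: "cfourier (\<lambda>x. f x * of_real (p (cis (2 * pi * x)))) 0 = 0" using pw z by simp_all
      have "norm (integral {0..1} (\<lambda>x. f x * of_real (g x)) 
              - integral {0..1} (\<lambda>x. f x * of_real (p (cis (2 * pi * x))))) 
         \<le> e * (1 - 0)"
      proof (subst integral_diff[symmetric])
        show "norm (integral {0..1} (\<lambda>x. f x * of_real (g x) - f x * of_real (p (cis (2 * pi * x)))))
          \<le> e * (1 - 0)"
        proof (rule integral_bound)
          fix x :: real assume x: "x \<in> {0..1}"
          have "norm (f x * of_real (g x) - f x * of_real (p (cis (2 * pi * x))))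
             = norm (f x) * \<bar>F (cis (2 * pi * x)) - p (cis (2 * pi * x))\<bar>"
            unfolding F(2)[OF x] 
            by (simp flip: right_diff_distrib of_real_diff add: norm_mult)
          also have "\<dots> \<le> M * (e / M)"
            using M(1)[OF x] p(2)[of "cis (2 * pi * x)"] M(2) by (intro mult_mono) auto
          finally show "norm (f x * of_real (g x) - f x * of_real (p (cis (2 * pi * x)))) \<le> e"
            using M by simp
        qed (auto intro!: continuous_intros f g pc)
      qed (auto intro!: integrable_continuous_real continuous_intros f g pc)
      then show ?thesis using p0 by (simp add: cfourier_def)
    qed
    then have "norm (integral {0..1} (\<lambda>x. f x * of_real (g x))) \<le> 0"
      by (rule field_le_epsilon) auto
    then show ?thesis by simp
  qed
  have i: "(\<lambda>x. f x * of_real (g x)) integrable_on {0..1}" if "continuous_on {0..1} g" for g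
    by (intro integrable_continuous_real continuous_intros f that)
  have "Re (integral {0..1} (\<lambda>x. f x * of_real (Re (f x)))) = integral {0..1} (\<lambda>x. (Re (f x))\<^sup>2)"
    using integral_linear[OF i bounded_linear_Re, of "\<lambda>x. Re (f x)"] f
    by (simp add: o_def power2_eq_square continuous_on_Re)
  then have "integral {0..1} (\<lambda>x. (Re (f x))\<^sup>2) = 0"
    using orth[of "\<lambda>x. Re (f x)"] f by (simp add: continuous_on_Re)
  then have re: "\<forall>x\<in>{0..1}. (Re (f x))\<^sup>2 = 0"
    by (subst (asm) integral_eq_0_iff) (auto intro!: continuous_intros f)
  have "Im (integral {0..1} (\<lambda>x. f x * of_real (Im (f x)))) = integral {0..1} (\<lambda>x. (Im (f x))\<^sup>2)"
    using integral_linear[OF i bounded_linear_Im, of "\<lambda>x. Im (f x)"] f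
    by (simp add: o_def power2_eq_square continuous_on_Im)
  then have "integral {0..1} (\<lambda>x. (Im (f x))\<^sup>2) = 0"
    using orth[of "\<lambda>x. Im (f x)"] f by (simp add: continuous_on_Im)
  then have im: "\<forall>x\<in>{0..1}. (Im (f x))\<^sup>2 = 0"
    by (subst (asm) integral_eq_0_iff) (auto intro!: continuous_intros f)
  show ?thesis using re im x by (simp add: complex_eq_iff)
qed

lemma periodic_frac:
  fixes f :: "real \<Rightarrow> 'a"
  assumes "\<And>x. f (x + 1) = f x"
  shows "f (frac x) = f x"
proof -
  interpret periodic_fun_simple' f by standard (rule assms)
  show ?thesis using minus_of_int[of x "\<lfloor>x\<rfloor>"] by (simp add: frac_def)
qed

lemma fourier_uniqueness_periodic:
  fixes f :: "real \<Rightarrow> complex"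
  assumes f: "continuous_on UNIV f" "\<And>x. f (x + 1) = f x" and z: "\<And>n. n \<noteq> 0 \<Longrightarrow> cfourier f n = 0"
  shows "f x = cfourier f 0"
proof -
  define c where "c = cfourier f 0"
  have f': "continuous_on {0..1} f" using f(1) continuous_on_subset by blast
  have one: "cfourier (\<lambda>_. c) n = (if n = 0 then c else 0)" for n :: int
  proof (cases "n = 0")
    case False
    have "((\<lambda>x. c * cis (- (2 * pi * of_int n * x))) has_integral
       (c * cis (- (2 * pi * of_int n * 1)) / (- 2 * pi * of_int n * \<i>) 
        - c * cis (- (2 * pi * of_int n * 0)) / (- 2 * pi * of_int n * \<i>))) {0..1}"
    proof (rule fundamental_theorem_of_calculus)
      fix x :: real assume "x \<in> {0..1}"
      show "((\<lambda>x. c * cis (- (2 * pi * of_int n * x)) / (- 2 * pi * of_int n * \<i>)) has_vector_derivative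
          c * cis (- (2 * pi * of_int n * x))) (at x within {0..1})"
        unfolding cis_conv_exp
        by (rule derivative_eq_intros has_vector_derivative_real_field
             | simp add: False field_simps scaleR_conv_of_real)+
    qed simp
    moreover have "cis (- (2 * pi * of_int n)) = 1" 
      using cis_multiple_2pi[of "- of_int n"] by simp
    ultimately have "((\<lambda>x. c * cis (- (2 * pi * of_int n * x))) has_integral 0) {0..1}" by simp
    then have "cfourier (\<lambda>_. c) n = 0" unfolding cfourier_def by (rule integral_unique)
    then show ?thesis using False by simp
  qed (simp add: cfourier_def)
  have "cfourier (\<lambda>x. f x - c) n = cfourier f n - cfourier (\<lambda>_. c) n" for n
    unfolding cfourier_def left_diff_distrib
    by (intro integral_diff integrable_continuous_real continuous_intros f')
  then have "cfourier (\<lambda>x. f x - c) n = 0" for n using z[of n] one by (auto simp: c_def)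
  then have "f (frac x) - c = 0"
    using f(2)[of 0] by (intro fourier_uniqueness[of "\<lambda>x. f x - c"] continuous_intros f')
       (auto simp: frac_lt_1 less_imp_le)
  then show ?thesis using periodic_frac[of f] f(2) by (simp add: c_def)
qed

text \<open>
  Integration by parts; the boundary terms cancel because \<open>D\<close> has equal values at both ends.
\<close>
lemma cfourier_derivative:
  fixes D d :: "real \<Rightarrow> complex"
  assumes D: "\<And>x. (D has_vector_derivative d x) (at x)" and d: "continuous_on {0..1} d"
    and eq: "D 1 = D 0"
  shows "cfourier d n = 2 * pi * of_int n * \<i> * cfourier D n"
proof -
  have cD: "continuous_on {0..1} D"
    by (meson D continuous_at_imp_continuous_on has_vector_derivative_continuous)
  have "((\<lambda>x. d x * cis (- (2 * pi * of_int n * x)) - 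
           2 * pi * of_int n * \<i> * (D x * cis (- (2 * pi * of_int n * x)))) has_integral
     (D 1 * cis (- (2 * pi * of_int n * 1)) - D 0 * cis (- (2 * pi * of_int n * 0)))) {0..1}"
  proof (rule fundamental_theorem_of_calculus)
    fix x :: real assume "x \<in> {0..1}"
    have c: "((\<lambda>x. cis (- (2 * pi * of_int n * x))) has_vector_derivative
       - (2 * pi * of_int n * \<i>) * cis (- (2 * pi * of_int n * x))) (at x within {0..1})"
      unfolding cis_conv_exp
      by (rule derivative_eq_intros has_vector_derivative_real_field
           | simp add: field_simps scaleR_conv_of_real)+
    show "((\<lambda>x. D x * cis (- (2 * pi * of_int n * x))) has_vector_derivative
      d x * cis (- (2 * pi * of_int n * x)) - 
           2 * pi * of_int n * \<i> * (D x * cis (- (2 * pi * of_int n * x)))) (at x within {0..1})"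
      using has_vector_derivative_mult[OF has_vector_derivative_at_within[OF D] c]
      by (simp add: algebra_simps)
  qed simp
  moreover have "cis (- (2 * pi * of_int n)) = 1" 
    using cis_multiple_2pi[of "- of_int n"] by simp
  ultimately have "integral {0..1} (\<lambda>x. d x * cis (- (2 * pi * of_int n * x)) - 
           2 * pi * of_int n * \<i> * (D x * cis (- (2 * pi * of_int n * x)))) = 0"
    using eq by (simp add: integral_unique)
  moreover have "integral {0..1} (\<lambda>x. d x * cis (- (2 * pi * of_int n * x)) - 
           2 * pi * of_int n * \<i> * (D x * cis (- (2 * pi * of_int n * x)))) = 
      cfourier d n - 2 * pi * of_int n * \<i> * cfourier D n"
    unfolding cfourier_def integral_mult_right[symmetric]
    by (intro integral_diff integrable_continuous_real continuous_intros d cD)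
  ultimately show ?thesis by simp
qed

lemma cfourier_character: "cfourier (\<lambda>x. c * cis (2 * pi * of_int m * x)) n = (if n = m then c else 0)"
proof (cases "n = m")
  case True
  have "c * cis (2 * pi * of_int m * x) * cis (- (2 * pi * of_int m * x)) = c" for x
    by (simp add: cis_mult mult.assoc)
  then have "cfourier (\<lambda>x. c * cis (2 * pi * of_int m * x)) m = integral {0..1} (\<lambda>x::real. c)"
    unfolding cfourier_def by (simp only:)
  then show ?thesis using True by simp
next
  case False
  have e: "c * cis (2 * pi * of_int m * x) * cis (- (2 * pi * of_int n * x)) =
     c * cis (- (2 * pi * of_int (n - m) * x))" for x
    by (simp add: cis_mult mult.assoc algebra_simps)
  have "cfourier (\<lambda>x. 0) (n - m) = 2 * pi * of_int (n - m) * \<i> * cfourier (\<lambda>_. c) (n - m)"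
    by (rule cfourier_derivative) auto
  then have "cfourier (\<lambda>_. c) (n - m) = 0" using False by (simp add: cfourier_def)
  then show ?thesis using False unfolding cfourier_def e by simp
qed

section \<open>Absolutely convergent Fourier series\<close>

text \<open>
  The series converges uniformly, so it may be integrated term by term against a character.
\<close>
lemma fourier_series:
  fixes c :: "int \<Rightarrow> complex"
  assumes c: "(\<lambda>n. norm (c n)) summable_on UNIV"
  defines "S \<equiv> \<lambda>x. \<Sum>\<^sub>\<infinity>n. c n * cis (2 * pi * of_int n * x)"
  shows "continuous_on UNIV S" "S (x + 1) = S x" "cfourier S n = c n" 
    "norm (S x) \<le> (\<Sum>\<^sub>\<infinity>n. norm (c n))"
proof -
  have u: "uniform_limit UNIV (\<lambda>N x. \<Sum>n\<in>N. c n * cis (2 * pi * of_int n * x)) S 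
     (finite_subsets_at_top UNIV)"
    unfolding S_def using c by (intro Weierstrass_m_test_general) (auto simp: norm_mult)
  show cont: "continuous_on UNIV S"
    by (rule uniform_limit_theorem[OF _ u]) (auto intro!: always_eventually continuous_intros)
  have "cis (2 * pi * of_int n * (x + 1)) = cis (2 * pi * of_int n * x)" for n :: int
  proof -
    have "cis (2 * pi * of_int n * (x + 1)) = cis (2 * pi * of_int n * x) * cis (2 * pi * of_int n)"
      by (simp add: cis_mult algebra_simps)
    then show ?thesis by simp
  qed
  then show "S (x + 1) = S x" by (simp add: S_def)
  have "norm (S x) \<le> (\<Sum>\<^sub>\<infinity>n. norm (c n * cis (2 * pi * of_int n * x)))"
    unfolding S_def by (rule norm_infsum_bound) (simp add: norm_mult c)
  then show "norm (S x) \<le> (\<Sum>\<^sub>\<infinity>n. norm (c n))" by (simp add: norm_mult)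
  show "cfourier S n = c n"
  proof -
    have "uniform_limit {0..1} (\<lambda>N x. (\<Sum>m\<in>N. c m * cis (2 * pi * of_int m * x)) * cis (- (2 * pi * of_int n * x)))
       (\<lambda>x. S x * cis (- (2 * pi * of_int n * x))) (finite_subsets_at_top UNIV)"
    proof (rule uniform_limitI)
      fix e :: real assume "e > 0"
      from uniform_limitD[OF u this]
      show "\<forall>\<^sub>F N in finite_subsets_at_top UNIV. \<forall>x\<in>{0..1}.
        dist ((\<Sum>m\<in>N. c m * cis (2 * pi * of_int m * x)) * cis (- (2 * pi * of_int n * x)))
          (S x * cis (- (2 * pi * of_int n * x))) < e"
        by (rule eventually_mono) (auto simp: dist_norm norm_mult simp flip: left_diff_distrib)
    qed
    then obtain I J where IJ:
      "\<And>N. ((\<lambda>x. (\<Sum>m\<in>N. c m * cis (2 * pi * of_int m * x)) * cis (- (2 * pi * of_int n * x))) has_integral I N) {0..1}"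
      "((\<lambda>x. S x * cis (- (2 * pi * of_int n * x))) has_integral J) {0..1}" 
      "(I \<longlongrightarrow> J) (finite_subsets_at_top UNIV)"
      by (rule uniform_limit_integral) (auto intro!: continuous_intros)
    have "I N = c n" if "finite N" "n \<in> N" for N
    proof -
      have "I N = integral {0..1} (\<lambda>x. \<Sum>m\<in>N. c m * cis (2 * pi * of_int m * x) * cis (- (2 * pi * of_int n * x)))"
        using IJ(1)[of N] by (simp add: integral_unique sum_distrib_right)
      also have "\<dots> = (\<Sum>m\<in>N. cfourier (\<lambda>x. c m * cis (2 * pi * of_int m * x)) n)"
        unfolding cfourier_def by (intro integral_sum that integrable_continuous_real continuous_intros)
      also have "\<dots> = c n" using that unfolding cfourier_character by simp
      finally show ?thesis .
    qed
    then have "\<forall>\<^sub>F N in finite_subsets_at_top UNIV. I N = c n"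
      unfolding eventually_finite_subsets_at_top by (intro exI[of _ "{n}"]) auto
    then have "(I \<longlongrightarrow> c n) (finite_subsets_at_top UNIV)" by (rule tendsto_eventually)
    then have "J = c n" using IJ(3) tendsto_unique finite_subsets_at_top_neq_bot by blast
    then show ?thesis using IJ(2) by (simp add: cfourier_def integral_unique)
  qed
qed

text \<open>
  Both sides are continuous and periodic and have the same Fourier coefficients.
\<close>
lemma fourier_inversion:
  fixes g :: "real \<Rightarrow> complex"
  assumes g: "continuous_on UNIV g" "\<And>x. g (x + 1) = g x"
    and c: "(\<lambda>n. norm (cfourier g n)) summable_on UNIV"
  shows "g x = (\<Sum>\<^sub>\<infinity>n. cfourier g n * cis (2 * pi * of_int n * x))"
proof -
  define S where "S x = (\<Sum>\<^sub>\<infinity>n. cfourier g n * cis (2 * pi * of_int n * x))" for x :: real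
  note S = fourier_series[OF c, folded S_def]
  have sub: "continuous_on {0..1} g" "continuous_on {0..1} S"
    using g(1) S(1) continuous_on_subset by blast+
  have z: "cfourier (\<lambda>x. g x - S x) n = 0" for n
  proof -
    have "cfourier (\<lambda>x. g x - S x) n = cfourier g n - cfourier S n"
      unfolding cfourier_def left_diff_distrib
      by (intro integral_diff integrable_continuous_real continuous_intros sub)
    then show ?thesis by (simp add: S)
  qed
  have "g x - S x = cfourier (\<lambda>x. g x - S x) 0"
    by (rule fourier_uniqueness_periodic[of "\<lambda>x. g x - S x"])
       (use z in \<open>auto intro!: continuous_intros g S simp: S(2) g(2)\<close>)
  then show ?thesis using z by (simp add: S_def)
qed

lemma summable_inverse_weight: "(\<lambda>n::int. 1 / (1 + (2 * pi * of_int n)\<^sup>2)) summable_on UNIV"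
proof -
  have "summable (\<lambda>n::nat. 1 / (of_nat (Suc n))\<^sup>2 :: real)"
    using inverse_squares_sums by (simp add: sums_iff)
  then have s: "summable (\<lambda>n::nat. 1 / (1 + (2 * pi * of_nat n)\<^sup>2) :: real)"
  proof (subst summable_Suc_iff[symmetric], elim summable_comparison_test'[where N = 0])
    fix n :: nat
    have "1 * 1 \<le> (2 * pi) * (2 * pi)" using pi_ge_two by (intro mult_mono) auto
    then have "1 * (real (Suc n))\<^sup>2 \<le> (2 * pi)\<^sup>2 * (real (Suc n))\<^sup>2"
      by (intro mult_right_mono) (auto simp: power2_eq_square)
    then have "(real (Suc n))\<^sup>2 \<le> 1 + (2 * pi * of_nat (Suc n))\<^sup>2"
      unfolding power_mult_distrib by linarith
    then show "norm (1 / (1 + (2 * pi * of_nat (Suc n))\<^sup>2) :: real) \<le> 1 / (real (Suc n))\<^sup>2"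
      by (auto intro!: divide_left_mono mult_pos_pos add_pos_nonneg simp del: of_nat_Suc)
  qed
  have nat: "(\<lambda>n::nat. 1 / (1 + (2 * pi * of_nat n)\<^sup>2) :: real) summable_on UNIV"
    using s by (subst summable_on_UNIV_nonneg_real_iff) auto
  have "(\<lambda>n::int. 1 / (1 + (2 * pi * of_int n)\<^sup>2)) summable_on range int"
    using nat by (subst summable_on_reindex) (auto simp: o_def)
  moreover have "(\<lambda>n::int. 1 / (1 + (2 * pi * of_int n)\<^sup>2)) summable_on range (\<lambda>n. - int n)"
    using nat by (subst summable_on_reindex) (auto simp: o_def inj_on_def)
  moreover have "UNIV = range int \<union> range (\<lambda>n. - int n)"
  proof safe
    fix n :: int assume "n \<notin> range (\<lambda>n. - int n)"
    then show "n \<in> range int" by (cases n rule: int_cases2) auto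
  qed auto
  ultimately show ?thesis by (metis summable_on_union)
qed

definition embedding_const :: real where
  "embedding_const = sqrt (\<Sum>\<^sub>\<infinity>n::int. 1 / (1 + (2 * pi * of_int n)\<^sup>2))"

lemma embedding_const_nonneg: "embedding_const \<ge> 0"
  unfolding embedding_const_def by (intro real_sqrt_ge_zero infsum_nonneg) auto

text \<open>
  The Cauchy-Schwarz inequality with the weight \<open>1 + (2\<pi>n)\<^sup>2\<close>, whose reciprocal is summable.  Applied to
  \<open>|g\<^sub>n|\<close> it gives the embedding of \<open>H\<^sup>1\<close> into continuous functions, applied to \<open>|2\<pi>n g\<^sub>n|\<close> that of
  \<open>H\<^sup>2\<close> into \<open>C\<^sup>1\<close>.
\<close>
lemma weighted_l2_imp_l1:
  fixes a b :: "int \<Rightarrow> real"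
  assumes a: "\<And>n. a n \<ge> 0" and b: "b summable_on UNIV"
    and ab: "\<And>n. (1 + (2 * pi * of_int n)\<^sup>2) * (a n)\<^sup>2 \<le> b n"
  shows "a summable_on UNIV" "infsum a UNIV \<le> embedding_const * sqrt (infsum b UNIV)"
proof -
  let ?w = "\<lambda>n::int. 1 + (2 * pi * of_int n)\<^sup>2"
  have b0: "b n \<ge> 0" for n using ab[of n] by (meson order_trans add_nonneg_nonneg mult_nonneg_nonneg zero_le_one zero_le_power2)
  have wpos: "?w n > 0" for n by (simp add: add_pos_nonneg)
  have le: "sum a F \<le> embedding_const * sqrt (infsum b UNIV)" if F: "finite F" for F
  proof -
    have A: "L2_set (\<lambda>n. 1 / sqrt (?w n)) F \<le> embedding_const"
      unfolding L2_set_def embedding_const_def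
      using finite_sum_le_infsum[OF summable_inverse_weight F] wpos
      by (intro real_sqrt_le_mono) (simp add: power_divide less_imp_le)
    have B: "L2_set (\<lambda>n. sqrt (?w n) * a n) F \<le> sqrt (infsum b UNIV)"
      unfolding L2_set_def
    proof (rule real_sqrt_le_mono)
      have "(\<Sum>n\<in>F. (sqrt (?w n) * a n)\<^sup>2) \<le> sum b F"
        using ab wpos by (intro sum_mono) (simp add: power_mult_distrib less_imp_le)
      also have "\<dots> \<le> infsum b UNIV" by (rule finite_sum_le_infsum[OF b F]) (auto simp: b0)
      finally show "(\<Sum>n\<in>F. (sqrt (?w n) * a n)\<^sup>2) \<le> infsum b UNIV" .
    qed
    have "sum a F = (\<Sum>n\<in>F. \<bar>1 / sqrt (?w n)\<bar> * \<bar>sqrt (?w n) * a n\<bar>)"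
      using wpos a by (intro sum.cong) (auto simp: abs_mult, metis less_irrefl)
    also have "\<dots> \<le> L2_set (\<lambda>n. 1 / sqrt (?w n)) F * L2_set (\<lambda>n. sqrt (?w n) * a n) F"
      by (rule L2_set_mult_ineq)
    also have "\<dots> \<le> embedding_const * sqrt (infsum b UNIV)"
      by (intro mult_mono A B L2_set_nonneg embedding_const_nonneg)
    finally show ?thesis .
  qed
  show "a summable_on UNIV"
    by (rule nonneg_bdd_above_summable_on) (use a le in \<open>auto intro!: bdd_aboveI2\<close>)
  then show "infsum a UNIV \<le> embedding_const * sqrt (infsum b UNIV)"
    by (rule infsum_le_finite_sums) (use le in auto)
qed

section \<open>Sobolev spaces on the circle\<close>

lemma fourier_coeff_eq_cfourier:
  assumes "continuous_on UNIV g"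
  shows "fourier_coeff g n = cfourier (\<lambda>x. of_real (g x)) n"
proof -
  have "continuous_on {0..1} g" using assms continuous_on_subset by blast
  then have "set_integrable lborel {0..1} (\<lambda>x. complex_of_real (g x) * cis (- (2 * pi * of_int n * x)))"
    by (intro borel_integrable_atLeastAtMost' continuous_intros)
  then show ?thesis
    unfolding fourier_coeff_def cfourier_def by (rule set_borel_integral_eq_integral)
qed

lemma sobolev_term_lower:
  assumes "real k \<le> r"
  shows "(1 + (2 * pi * of_int n)\<^sup>2) ^ k * (cmod (fourier_coeff g n))\<^sup>2 \<le> sobolev_term r g n"
proof -
  have "(1 + (2 * pi * of_int n)\<^sup>2) ^ k = (1 + (2 * pi * of_int n)\<^sup>2) powr real k"
    by (subst powr_realpow) (auto intro: add_pos_nonneg)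
  also have "\<dots> \<le> (1 + (2 * pi * of_int n)\<^sup>2) powr r"
    using assms by (intro powr_mono) auto
  finally show ?thesis unfolding sobolev_term_def by (intro mult_right_mono) auto
qed

lemma sobolev_term_nonneg: "sobolev_term r g n \<ge> 0"
  by (simp add: sobolev_term_def)

text \<open>
  Fourier inversion holds for \<open>g\<close> because its coefficients are summable, and the sum of their absolute
  values bounds \<open>g\<close>.
\<close>
lemma sobolev_sup_bound:
  assumes "r \<ge> 1" "g \<in> sobolev r"
  shows "\<bar>g x\<bar> \<le> embedding_const * sobolev_norm r g"
proof -
  have g: "continuous_on UNIV g" "\<And>x. g (x + 1) = g x" "sobolev_term r g summable_on UNIV"
    using assms by (auto simp: sobolev_def periodic1_def)
  let ?c = "cfourier (\<lambda>x. complex_of_real (g x))"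
  have le: "(1 + (2 * pi * of_int n)\<^sup>2) * (norm (?c n))\<^sup>2 \<le> sobolev_term r g n" for n
    using sobolev_term_lower[of 1 r n g] assms(1) g(1) by (simp add: fourier_coeff_eq_cfourier)
  note s = weighted_l2_imp_l1[of "\<lambda>n. norm (?c n)", OF _ g(3) le]
  have "complex_of_real (g x) = (\<Sum>\<^sub>\<infinity>n. ?c n * cis (2 * pi * of_int n * x))"
    using g s(1) by (intro fourier_inversion continuous_intros) auto
  then have "norm (complex_of_real (g x)) \<le> (\<Sum>\<^sub>\<infinity>n. norm (?c n))"
    using fourier_series(4)[of ?c x] s(1) by simp
  with s(2) show ?thesis by (simp add: sobolev_norm_def)
qed

text \<open>
  A periodic function with mean zero has a periodic antiderivative, since the increment of the
  antiderivative over one period is constant and equal to the mean.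
\<close>
lemma periodic_antiderivative:
  fixes G H :: "real \<Rightarrow> complex"
  assumes G: "continuous_on UNIV G" "\<And>x. G (x + 1) = G x" "cfourier G 0 = 0"
    and H: "\<And>x. (H has_vector_derivative G x) (at x)"
  shows "H (x + 1) = H x" "cfourier G n = 2 * pi * of_int n * \<i> * cfourier H n"
proof -
  have G01: "continuous_on {0..1} G" using G(1) continuous_on_subset by blast
  have "(G has_integral H 1 - H 0) {0..1}"
    by (rule fundamental_theorem_of_calculus) (auto intro: has_vector_derivative_at_within H)
  moreover have "integral {0..1} G = cfourier G 0" by (simp add: cfourier_def)
  ultimately have H01: "H 1 = H 0" by (simp add: integral_unique G(3))
  have Hper: "H (x + 1) = H x" for x
  proof -
    have "((\<lambda>x. H (x + 1) - H x) has_vector_derivative 0) (at x within UNIV)" for x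
    proof -
      have "((\<lambda>x. x + 1) has_real_derivative 1) (at x)"
        by (auto intro!: derivative_eq_intros)
      then have "((\<lambda>x. x + 1) has_vector_derivative 1) (at x)"
        by (simp add: has_real_derivative_iff_has_vector_derivative)
      then have "((\<lambda>x. H (x + 1)) has_vector_derivative G x) (at x)"
        using vector_diff_chain_at[of "\<lambda>x. x + 1" 1 x H "G (x + 1)"] H[of "x + 1"] G(2)
        by (simp add: o_def)
      from has_vector_derivative_diff[OF this H[of x]] show ?thesis by simp
    qed
    then obtain c where "\<And>x. H (x + 1) - H x = c"
      using has_vector_derivative_zero_constant[of UNIV "\<lambda>x. H (x + 1) - H x"] by auto
    from this[of 0] this[of x] H01 show ?thesis by simp
  qed
  show "H (x + 1) = H x" by (rule Hper)
  show "cfourier G n = 2 * pi * of_int n * \<i> * cfourier H n" using cfourier_derivative[OF H G01 H01] .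
qed

text \<open>
  The termwise differentiated Fourier series converges uniformly to a continuous function \<open>G\<close>.  Its
  antiderivative \<open>H\<close> has the Fourier coefficients of \<open>g\<close> at all nonzero frequencies, so \<open>g - H\<close> is
  constant and \<open>g' = G\<close>.
\<close>
lemma sobolev_imp_C1:
  assumes "r \<ge> 2" "g \<in> sobolev r"
  shows "(g has_real_derivative deriv g x) (at x)" "continuous_on UNIV (deriv g)"
    "\<bar>deriv g x\<bar> \<le> embedding_const * sobolev_norm r g"
proof -
  have g: "continuous_on UNIV g" "\<And>x. g (x + 1) = g x" "sobolev_term r g summable_on UNIV"
    using assms by (auto simp: sobolev_def periodic1_def)
  let ?c = "cfourier (\<lambda>x. complex_of_real (g x))"
  define d where "d n = 2 * pi * of_int n * \<i> * ?c n" for n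
  have le: "(1 + (2 * pi * of_int n)\<^sup>2) * (norm (d n))\<^sup>2 \<le> sobolev_term r g n" for n
  proof -
    have "(norm (d n))\<^sup>2 = (2 * pi * of_int n)\<^sup>2 * (norm (?c n))\<^sup>2"
      by (simp add: d_def norm_mult power_mult_distrib)
    also have "\<dots> \<le> (1 + (2 * pi * of_int n)\<^sup>2) * (norm (?c n))\<^sup>2"
      by (intro mult_right_mono) auto
    finally have "(1 + (2 * pi * of_int n)\<^sup>2) * (norm (d n))\<^sup>2 
        \<le> (1 + (2 * pi * of_int n)\<^sup>2) * ((1 + (2 * pi * of_int n)\<^sup>2) * (norm (?c n))\<^sup>2)"
      by (intro mult_left_mono) auto
    also have "\<dots> \<le> sobolev_term r g n"
      using sobolev_term_lower[of 2 r n g] assms(1) g(1) 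
      by (simp add: fourier_coeff_eq_cfourier power2_eq_square mult.assoc)
    finally show ?thesis .
  qed
  note s = weighted_l2_imp_l1[of "\<lambda>n. norm (d n)", OF _ g(3) le]
  define G where "G x = (\<Sum>\<^sub>\<infinity>n. d n * cis (2 * pi * of_int n * x))" for x :: real
  have sd: "(\<lambda>n. norm (d n)) summable_on UNIV" using s(1) by simp
  note G = fourier_series[OF sd, folded G_def]
  obtain H where H: "\<And>x. (H has_vector_derivative G x) (at x)"
    using einterval_antiderivative[of "-\<infinity>" "\<infinity>" G] G(1)
    by (auto simp: continuous_on_eq_continuous_at)
  have cH: "continuous_on UNIV H"
    by (meson H continuous_at_imp_continuous_on has_vector_derivative_continuous)
  have mean: "cfourier G 0 = 0" by (simp add: G(3) d_def)
  note per = periodic_antiderivative[OF G(1) G(2) mean H]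
  have sub: "continuous_on {0..1} g" "continuous_on {0..1} H"
    using g(1) cH continuous_on_subset by blast+
  have "cfourier (\<lambda>x. of_real (g x) - H x) n = 0" if "n \<noteq> 0" for n
  proof -
    have "cfourier (\<lambda>x. of_real (g x) - H x) n = ?c n - cfourier H n"
      unfolding cfourier_def left_diff_distrib
      by (intro integral_diff integrable_continuous_real continuous_intros sub)
    moreover have "2 * pi * of_int n * \<i> * ?c n = 2 * pi * of_int n * \<i> * cfourier H n"
      using per(2)[of n] G(3)[of n] by (simp add: d_def)
    ultimately show ?thesis using that by simp
  qed
  then have eq: "of_real (g x) - H x = cfourier (\<lambda>x. of_real (g x) - H x) 0" for x
    by (intro fourier_uniqueness_periodic[of "\<lambda>x. of_real (g x) - H x"])
       (auto intro!: continuous_intros g cH simp: g(2) per(1))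
  define k where "k = cfourier (\<lambda>x. of_real (g x) - H x) 0"
  have "complex_of_real (g x) = k + H x" for x using eq[of x] by (simp add: k_def algebra_simps)
  then have gH: "g x = Re (k + H x)" for x by (metis Re_complex_of_real)
  have der: "(g has_real_derivative Re (G x)) (at x)" for x
  proof -
    have "((\<lambda>x. k + H x) has_vector_derivative G x) (at x)"
      using has_vector_derivative_add[OF has_vector_derivative_const H[of x]] by simp
    then have "((\<lambda>x. Re (k + H x)) has_vector_derivative Re (G x)) (at x)"
      by (rule bounded_linear.has_vector_derivative[OF bounded_linear_Re])
    then show ?thesis unfolding gH[symmetric] has_real_derivative_iff_has_vector_derivative by simp
  qed
  then have dg: "deriv g x = Re (G x)" for x by (rule DERIV_imp_deriv)
  show "(g has_real_derivative deriv g x) (at x)" using der dg by simp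
  show "continuous_on UNIV (deriv g)" using dg G(1) by (simp add: continuous_on_Re)
  have "\<bar>Re (G x)\<bar> \<le> norm (G x)" by (rule abs_Re_le_cmod)
  also have "\<dots> \<le> (\<Sum>\<^sub>\<infinity>n. norm (d n))" by (rule G(4))
  finally show "\<bar>deriv g x\<bar> \<le> embedding_const * sobolev_norm r g"
    using s(2) by (simp add: sobolev_norm_def dg)
qed

lemma set_integrable_of_square:
  fixes f :: "real \<Rightarrow> real"
  assumes "f \<in> borel_measurable borel" "set_integrable lborel {0..1} (\<lambda>x. (f x)\<^sup>2)"
  shows "set_integrable lborel {0..1} f"
proof (rule set_integrable_bound)
  show "set_integrable lborel {0..1} (\<lambda>x. 1 + (f x)\<^sup>2)"
    by (intro set_integral_add(1) assms(2)) (intro borel_integrable_atLeastAtMost' continuous_intros)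
  have "\<bar>f x\<bar> \<le> 1 + (f x)\<^sup>2" for x
    using power2_diff[of "\<bar>f x\<bar>" 1] zero_le_power2[of "\<bar>f x\<bar> - 1"] abs_ge_zero[of "f x"]
    by (simp only: power2_abs one_power2 mult_1_right)
  then show "AE x in lborel. x \<in> {0..1} \<longrightarrow> norm (f x) \<le> norm (1 + (f x)\<^sup>2)"
    by (auto simp: abs_of_nonneg intro!: AE_I2 order_trans[OF _ abs_ge_self])
qed (use assms(1) in \<open>auto simp: set_borel_measurable_def\<close>)

lemma fourier_integrable:
  assumes "set_integrable lborel {0..1} g"
  shows "set_integrable lborel {0..1} (\<lambda>x. complex_of_real (g x) * cis (- (2 * pi * of_int n * x)))"
proof (rule set_integrable_bound)
  show "set_integrable lborel {0..1} g" by fact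
  have "(\<lambda>x. indicator {0..1} x *\<^sub>R g x) \<in> borel_measurable lborel"
    using assms unfolding set_integrable_def by (rule borel_measurable_integrable)
  moreover have "(\<lambda>x. cis (- (2 * pi * of_int n * x))) \<in> borel_measurable borel"
    by (intro borel_measurable_continuous_onI continuous_intros)
  ultimately have "(\<lambda>x. complex_of_real (indicator {0..1} x *\<^sub>R g x) * cis (- (2 * pi * of_int n * x))) 
       \<in> borel_measurable lborel" by (intro borel_measurable_times borel_measurable_of_real) (simp_all del: of_real_mult)
  then show "set_borel_measurable lborel {0..1} (\<lambda>x. complex_of_real (g x) * cis (- (2 * pi * of_int n * x)))"
    unfolding set_borel_measurable_def by (simp add: scaleR_conv_of_real mult.assoc)
qed (auto simp: norm_mult)

text \<open>
  The norm of a difference carries information only if the difference lies in the space, because a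
  divergent infinite sum has value 0; this is what makes the convergence statements in the definition of
  a solution usable.
\<close>
lemma sobolev_linear_combination:
  assumes f: "f \<in> sobolev r" and g: "g \<in> sobolev r"
  shows "(\<lambda>x. a * f x + b * g x) \<in> sobolev r"
    "fourier_coeff (\<lambda>x. a * f x + b * g x) n = a * fourier_coeff f n + b * fourier_coeff g n"
proof -
  let ?h = "\<lambda>x. a * f x + b * g x"
  have m: "f \<in> borel_measurable borel" "g \<in> borel_measurable borel"
    and sq: "set_integrable lborel {0..1} (\<lambda>x. (f x)\<^sup>2)" "set_integrable lborel {0..1} (\<lambda>x. (g x)\<^sup>2)"
    and su: "sobolev_term r f summable_on UNIV" "sobolev_term r g summable_on UNIV"
    using f g by (auto simp: sobolev_def)
  note int = fourier_integrable[OF set_integrable_of_square[OF m(1) sq(1)]]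
    fourier_integrable[OF set_integrable_of_square[OF m(2) sq(2)]]
  have co: "fourier_coeff ?h n = a * fourier_coeff f n + b * fourier_coeff g n" for n
  proof -
    have "fourier_coeff ?h n = (LINT x:{0..1}|lborel. of_real a * (of_real (f x) * cis (- (2 * pi * of_int n * x)))
        + of_real b * (of_real (g x) * cis (- (2 * pi * of_int n * x))))"
      unfolding fourier_coeff_def by (simp add: algebra_simps)
    also have "\<dots> = a * fourier_coeff f n + b * fourier_coeff g n"
      unfolding fourier_coeff_def using int[of n]
      by (subst set_integral_add) auto
    finally show ?thesis .
  qed
  then show "fourier_coeff ?h n = a * fourier_coeff f n + b * fourier_coeff g n" .
  have young: "(a * x + b * y)\<^sup>2 \<le> 2 * a\<^sup>2 * x\<^sup>2 + 2 * b\<^sup>2 * y\<^sup>2" for x y :: real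
    using zero_le_power2[of "a * x - b * y"] by (simp add: power2_eq_square algebra_simps)
  have "set_integrable lborel {0..1} (\<lambda>x. (?h x)\<^sup>2)"
  proof (rule set_integrable_bound)
    show "set_integrable lborel {0..1} (\<lambda>x. 2 * a\<^sup>2 * (f x)\<^sup>2 + 2 * b\<^sup>2 * (g x)\<^sup>2)"
      by (intro set_integral_add set_integrable_mult_right sq)
    show "set_borel_measurable lborel {0..1} (\<lambda>x. (?h x)\<^sup>2)"
      unfolding set_borel_measurable_def using m by measurable
    show "AE x in lborel. x \<in> {0..1} \<longrightarrow> norm ((?h x)\<^sup>2) \<le> norm (2 * a\<^sup>2 * (f x)\<^sup>2 + 2 * b\<^sup>2 * (g x)\<^sup>2)"
      using young by (auto intro!: AE_I2 order_trans[OF _ abs_ge_self])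
  qed
  moreover have "sobolev_term r ?h summable_on UNIV"
  proof (rule summable_on_comparison_test)
    show "(\<lambda>n. 2 * a\<^sup>2 * sobolev_term r f n + 2 * b\<^sup>2 * sobolev_term r g n) summable_on UNIV"
      by (intro summable_on_add summable_on_cmult_right su)
    fix n
    have "(cmod (fourier_coeff ?h n))\<^sup>2 \<le> (\<bar>a\<bar> * cmod (fourier_coeff f n) + \<bar>b\<bar> * cmod (fourier_coeff g n))\<^sup>2"
      unfolding co by (intro power_mono order_trans[OF norm_triangle_ineq]) (auto simp: norm_mult)
    also have "\<dots> \<le> 2 * a\<^sup>2 * (cmod (fourier_coeff f n))\<^sup>2 + 2 * b\<^sup>2 * (cmod (fourier_coeff g n))\<^sup>2"
      using zero_le_power2[of "\<bar>a\<bar> * cmod (fourier_coeff f n) - \<bar>b\<bar> * cmod (fourier_coeff g n)"]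
      by (simp add: power2_sum power2_diff power_mult_distrib)
    finally show "sobolev_term r ?h n \<le> 2 * a\<^sup>2 * sobolev_term r f n + 2 * b\<^sup>2 * sobolev_term r g n"
      unfolding sobolev_term_def
      using mult_left_mono[of _ _ "(1 + (2 * pi * real_of_int n)\<^sup>2) powr r"] 
      by (fastforce simp: algebra_simps)
  qed (simp add: sobolev_term_nonneg)
  ultimately show "?h \<in> sobolev r"
    using f g m by (auto simp: sobolev_def periodic1_def intro!: continuous_intros)
qed

lemma fourier_coeff_le_sobolev_norm:
  assumes "r \<ge> 0" "g \<in> sobolev r"
  shows "cmod (fourier_coeff g n) \<le> sobolev_norm r g"
proof -
  have "(cmod (fourier_coeff g n))\<^sup>2 \<le> sobolev_term r g n"
    using sobolev_term_lower[of 0 r n g] assms by simp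
  also have "\<dots> \<le> infsum (sobolev_term r g) UNIV"
    using finite_sum_le_infsum[of "sobolev_term r g" UNIV "{n}"] assms
    by (auto simp: sobolev_def sobolev_term_nonneg)
  finally show ?thesis unfolding sobolev_norm_def by (rule real_le_rsqrt)
qed

lemma sobolev_diff:
  "f \<in> sobolev r \<Longrightarrow> g \<in> sobolev r \<Longrightarrow> (\<lambda>x. f x - g x) \<in> sobolev r"
  using sobolev_linear_combination(1)[of f r g 1 "-1"] by simp

section \<open>Curves in Sobolev spaces\<close>

lemma sobolev_C0_uniform_limit:
  assumes "sobolev_C0 I r f" "r \<ge> 1" "t \<in> I"
  shows "uniform_limit UNIV f (f t) (at t within I)"
proof (rule uniform_limitI)
  fix e :: real assume e: "e > 0"
  have "((\<lambda>\<tau>. embedding_const * sobolev_norm r (\<lambda>x. f \<tau> x - f t x)) \<longlongrightarrow> embedding_const * 0) (at t within I)"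
    using assms by (intro tendsto_intros) (auto simp: sobolev_C0_def)
  then have "\<forall>\<^sub>F \<tau> in at t within I. embedding_const * sobolev_norm r (\<lambda>x. f \<tau> x - f t x) < e"
    using e by (intro order_tendstoD) auto
  moreover have "\<forall>\<^sub>F \<tau> in at t within I. \<tau> \<in> I" by (simp add: eventually_at_filter)
  ultimately show "\<forall>\<^sub>F \<tau> in at t within I. \<forall>x\<in>UNIV. dist (f \<tau> x) (f t x) < e"
  proof eventually_elim
    case (elim \<tau>)
    have "(\<lambda>x. f \<tau> x - f t x) \<in> sobolev r" 
      using assms elim by (intro sobolev_diff) (auto simp: sobolev_C0_def)
    from sobolev_sup_bound[OF assms(2) this] elim(1) show ?case
      by (auto simp: dist_real_def intro: le_less_trans)
  qed
qed

lemma sobolev_C0_deriv_uniform_limit: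
  assumes "sobolev_C0 I r f" "r \<ge> 2" "t \<in> I"
  shows "uniform_limit UNIV (\<lambda>\<tau>. deriv (f \<tau>)) (deriv (f t)) (at t within I)"
proof (rule uniform_limitI)
  fix e :: real assume e: "e > 0"
  have "((\<lambda>\<tau>. embedding_const * sobolev_norm r (\<lambda>x. f \<tau> x - f t x)) \<longlongrightarrow> embedding_const * 0) (at t within I)"
    using assms by (intro tendsto_intros) (auto simp: sobolev_C0_def)
  then have "\<forall>\<^sub>F \<tau> in at t within I. embedding_const * sobolev_norm r (\<lambda>x. f \<tau> x - f t x) < e"
    using e by (intro order_tendstoD) auto
  moreover have "\<forall>\<^sub>F \<tau> in at t within I. \<tau> \<in> I" by (simp add: eventually_at_filter)
  ultimately show "\<forall>\<^sub>F \<tau> in at t within I. \<forall>x\<in>UNIV. dist (deriv (f \<tau>) x) (deriv (f t) x) < e"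
  proof eventually_elim
    case (elim \<tau>)
    have fs: "f \<tau> \<in> sobolev r" "f t \<in> sobolev r" using assms elim by (auto simp: sobolev_C0_def)
    have "deriv (\<lambda>x. f \<tau> x - f t x) x = deriv (f \<tau>) x - deriv (f t) x" for x
      by (intro DERIV_imp_deriv DERIV_diff sobolev_imp_C1(1)[OF assms(2)] fs)
    with sobolev_imp_C1(3)[OF assms(2) sobolev_diff[OF fs]] elim(1) show ?case
      by (fastforce simp: dist_real_def intro: le_less_trans)
  qed
qed

text \<open>
  A curve that is continuous into the continuous functions with the supremum norm is jointly continuous.
\<close>
lemma continuous_on_of_uniform_limit:
  fixes f :: "real \<Rightarrow> real \<Rightarrow> real"
  assumes c: "\<And>t. t \<in> I \<Longrightarrow> continuous_on UNIV (f t)"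
    and u: "\<And>t. t \<in> I \<Longrightarrow> uniform_limit UNIV f (f t) (at t within I)"
  shows "continuous_on (I \<times> UNIV) (\<lambda>(t, x). f t x)"
  unfolding continuous_on_iff
proof (intro ballI allI impI)
  fix q :: "real \<times> real" and e :: real assume q: "q \<in> I \<times> UNIV" and e: "e > 0"
  obtain t x where qx: "q = (t, x)" by (cases q)
  have t: "t \<in> I" using q by (simp add: qx)
  from uniform_limitD[OF u[OF t], of "e/2"] e
  obtain d where d: "d > 0" 
    "\<And>\<tau> y. \<tau> \<in> I \<Longrightarrow> \<tau> \<noteq> t \<Longrightarrow> dist \<tau> t < d \<Longrightarrow> dist (f \<tau> y) (f t y) < e/2"
    unfolding eventually_at by auto
  from c[OF t] e obtain d' where d': "d' > 0" "\<And>y. dist y x < d' \<Longrightarrow> dist (f t y) (f t x) < e/2"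
    unfolding continuous_on_iff by (metis UNIV_I half_gt_zero)
  show "\<exists>d>0. \<forall>p\<in>I \<times> UNIV. dist p q < d \<longrightarrow> 
      dist (case p of (t, x) \<Rightarrow> f t x) (case q of (t, x) \<Rightarrow> f t x) < e"
    unfolding qx
  proof (intro exI[of _ "min d d'"] conjI ballI impI)
    fix p assume p: "p \<in> I \<times> (UNIV :: real set)" "dist p (t, x) < min d d'"
    obtain \<tau> y where py: "p = (\<tau>, y)" by (cases p)
    have "dist \<tau> t < d" "dist y x < d'" 
      using p dist_fst_le[of p "(t,x)"] dist_snd_le[of p "(t,x)"] by (auto simp: py)
    then have "dist (f \<tau> y) (f t y) < e/2" "dist (f t y) (f t x) < e/2"
      using d(2)[of \<tau> y] d'(2)[of y] p e by (cases "\<tau> = t"; simp add: py)+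
    then show "dist (case p of (t, x) \<Rightarrow> f t x) (case (t, x) of (t, x) \<Rightarrow> f t x) < e"
      using dist_triangle[of "f \<tau> y" "f t x" "f t y"] by (simp add: py)
  qed (use d d' in auto)
qed

lemma sobolev_C1_quotient:
  assumes "sobolev_C1 I r f f'" "\<tau> \<in> I" "t \<in> I"
  shows "(\<lambda>x. (f \<tau> x - f t x) / (\<tau> - t) - f' t x) \<in> sobolev r"
    "fourier_coeff (\<lambda>x. (f \<tau> x - f t x) / (\<tau> - t) - f' t x) n =
      (fourier_coeff (f \<tau>) n - fourier_coeff (f t) n) / of_real (\<tau> - t) - fourier_coeff (f' t) n"
proof -
  have fs: "f \<tau> \<in> sobolev r" "f t \<in> sobolev r" "f' t \<in> sobolev r"
    using assms by (auto simp: sobolev_C1_def sobolev_C0_def)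
  define k where "k = 1 / (\<tau> - t)"
  have eq: "(\<lambda>x. (f \<tau> x - f t x) / (\<tau> - t) - f' t x) = (\<lambda>x. 1 * (k * f \<tau> x + (- k) * f t x) + (-1) * f' t x)"
    by (auto simp: k_def diff_divide_distrib)
  show "(\<lambda>x. (f \<tau> x - f t x) / (\<tau> - t) - f' t x) \<in> sobolev r"
    unfolding eq by (intro sobolev_linear_combination(1) fs)
  have "fourier_coeff (\<lambda>x. 1 * (k * f \<tau> x + (- k) * f t x) + (-1) * f' t x) n
     = of_real k * fourier_coeff (f \<tau>) n - of_real k * fourier_coeff (f t) n - fourier_coeff (f' t) n"
    using sobolev_linear_combination(2)[OF sobolev_linear_combination(1)[OF fs(1,2), of k "-k"] fs(3), of 1 "-1" n]
      sobolev_linear_combination(2)[OF fs(1,2), of k "-k" n] by simp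
  then show "fourier_coeff (\<lambda>x. (f \<tau> x - f t x) / (\<tau> - t) - f' t x) n =
      (fourier_coeff (f \<tau>) n - fourier_coeff (f t) n) / of_real (\<tau> - t) - fourier_coeff (f' t) n"
    unfolding eq by (simp add: k_def diff_divide_distrib of_real_divide)
qed

lemma sobolev_C1_pointwise_derivative:
  assumes "sobolev_C1 I r f f'" "r \<ge> 1" "t \<in> I"
  shows "((\<lambda>\<tau>. f \<tau> x) has_real_derivative f' t x) (at t within I)"
  unfolding has_field_derivative_iff
proof (rule LIM_zero_cancel, rule Lim_null_comparison)
  show "((\<lambda>\<tau>. embedding_const * sobolev_norm r (\<lambda>x. (f \<tau> x - f t x) / (\<tau> - t) - f' t x)) \<longlongrightarrow> 0) (at t within I)"
    using assms by (intro tendsto_mult_right_zero) (auto simp: sobolev_C1_def)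
  have "\<forall>\<^sub>F \<tau> in at t within I. \<tau> \<in> I" by (simp add: eventually_at_filter)
  then show "\<forall>\<^sub>F \<tau> in at t within I. norm ((f \<tau> x - f t x) / (\<tau> - t) - f' t x)
      \<le> embedding_const * sobolev_norm r (\<lambda>x. (f \<tau> x - f t x) / (\<tau> - t) - f' t x)"
    by eventually_elim
       (use sobolev_sup_bound[OF assms(2) sobolev_C1_quotient(1)[OF assms(1) _ assms(3)]] in simp)
qed

text \<open>
  For small \<open>r\<close> the norm does not control pointwise values, but it bounds each Fourier coefficient, which
  may therefore be differentiated in time.
\<close>
lemma sobolev_C1_coeff_derivative:
  assumes "sobolev_C1 I r f f'" "r \<ge> 0" "t \<in> I"
  shows "((\<lambda>\<tau>. fourier_coeff (f \<tau>) n) has_vector_derivative fourier_coeff (f' t) n) (at t within I)"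
  unfolding has_vector_derivative_def has_derivative_iff_norm
proof (intro conjI bounded_linear_scaleR_left, rule Lim_null_comparison)
  show "((\<lambda>\<tau>. sobolev_norm r (\<lambda>x. (f \<tau> x - f t x) / (\<tau> - t) - f' t x)) \<longlongrightarrow> 0) (at t within I)"
    using assms by (auto simp: sobolev_C1_def)
  have "\<forall>\<^sub>F \<tau> in at t within I. \<tau> \<in> I \<and> \<tau> \<noteq> t" by (simp add: eventually_at_filter)
  then show "\<forall>\<^sub>F \<tau> in at t within I. norm (norm (fourier_coeff (f \<tau>) n - fourier_coeff (f t) n -
        (\<tau> - t) *\<^sub>R fourier_coeff (f' t) n) / norm (\<tau> - t))
      \<le> sobolev_norm r (\<lambda>x. (f \<tau> x - f t x) / (\<tau> - t) - f' t x)"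
  proof eventually_elim
    case (elim \<tau>)
    have "(fourier_coeff (f \<tau>) n - fourier_coeff (f t) n) / of_real (\<tau> - t) - fourier_coeff (f' t) n
      = (fourier_coeff (f \<tau>) n - fourier_coeff (f t) n - (\<tau> - t) *\<^sub>R fourier_coeff (f' t) n) / of_real (\<tau> - t)"
      using elim by (simp add: scaleR_conv_of_real field_simps flip: of_real_diff)
    with fourier_coeff_le_sobolev_norm[OF assms(2) sobolev_C1_quotient(1)[OF assms(1) _ assms(3)], of \<tau> n]
      sobolev_C1_quotient(2)[OF assms(1) _ assms(3), of \<tau> n] elim
    show ?case by (simp add: norm_divide flip: of_real_diff)
  qed
qed

section \<open>Characteristics and transport\<close>

lemma continuous_on_along:
  fixes g :: "real \<Rightarrow> real \<Rightarrow> real"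
  assumes g: "continuous_on (I \<times> UNIV) (\<lambda>(t, x). g t x)" and \<psi>: "continuous_on I \<psi>"
  shows "continuous_on I (\<lambda>t. g t (\<psi> t))"
proof -
  have "continuous_on I (\<lambda>t. case (t, \<psi> t) of (t, x) \<Rightarrow> g t x)"
    by (rule continuous_on_compose2[OF g]) (auto intro!: continuous_intros \<psi>)
  then show ?thesis by simp
qed

text \<open>
  Picard iteration on the whole time interval at once: successive differences are bounded by
  \<open>K exp(2Lt) / 2\<^sup>n\<close>, because integrating \<open>L exp(2Lt)\<close> halves the constant.
\<close>
lemma picard_lindelof_strip:
  fixes f :: "real \<Rightarrow> real \<Rightarrow> real"
  assumes T: "0 \<le> T" and f: "continuous_on ({0..T} \<times> UNIV) (\<lambda>(t, x). f t x)"
    and L: "L > 0" and lip: "\<And>t x y. t \<in> {0..T} \<Longrightarrow> \<bar>f t x - f t y\<bar> \<le> L * \<bar>x - y\<bar>"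
  obtains \<phi> where "\<phi> 0 = x0" 
    "\<And>t. t \<in> {0..T} \<Longrightarrow> (\<phi> has_real_derivative f t (\<phi> t)) (at t within {0..T})"
proof -
  define p where "p = rec_nat (\<lambda>t::real. x0) (\<lambda>_ q t. x0 + integral {0..t} (\<lambda>\<tau>. f \<tau> (q \<tau>)))"
  have p0: "p 0 = (\<lambda>t. x0)" and pS: "p (Suc n) = (\<lambda>t. x0 + integral {0..t} (\<lambda>\<tau>. f \<tau> (p n \<tau>)))" for n
    by (simp_all add: p_def)
  have comp: "continuous_on {0..T} (\<lambda>\<tau>. f \<tau> (q \<tau>))" if "continuous_on {0..T} q" for q
    using f that by (rule continuous_on_along)
  have cp: "continuous_on {0..T} (p n)" for n
  proof (induction n)
    case (Suc n)
    then show ?case unfolding pS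
      by (intro continuous_intros indefinite_integral_continuous_1 integrable_continuous_real comp)
  qed (simp add: p0)
  have int: "(\<lambda>\<tau>. f \<tau> (q \<tau>)) integrable_on {0..t}" if "continuous_on {0..T} q" "t \<in> {0..T}" for q t
    using that by (intro integrable_continuous_real continuous_on_subset[OF comp]) auto
  obtain M where M: "M \<ge> 0" "\<And>t. t \<in> {0..T} \<Longrightarrow> \<bar>f t x0\<bar> \<le> M"
  proof -
    have "bounded ((\<lambda>t. f t x0) ` {0..T})"
      by (intro compact_imp_bounded compact_continuous_image comp continuous_intros compact_Icc)
    then obtain M where "M > 0" "\<And>t. t \<in> {0..T} \<Longrightarrow> norm (f t x0) \<le> M"
      unfolding bounded_pos by (meson imageI)
    then show thesis by (intro that[of M]) auto
  qed
  define K where "K = M * T"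
  have K: "K \<ge> 0" using M T by (simp add: K_def)
  have diff: "\<bar>p (Suc n) t - p n t\<bar> \<le> K * exp (2 * L * t) / 2 ^ n" if "t \<in> {0..T}" for n t
    using that
  proof (induction n arbitrary: t)
    case 0
    have "norm (integral {0..t} (\<lambda>\<tau>. f \<tau> x0)) \<le> M * (t - 0)"
      using 0 M by (intro integral_bound) (auto intro: continuous_on_subset[OF comp])
    also have "\<dots> \<le> K * 1" using 0 M by (simp add: K_def mult_left_mono)
    also have "\<dots> \<le> K * exp (2 * L * t)" using K L 0 by (intro mult_left_mono) auto
    finally show ?case by (simp add: p0 pS)
  next
    case (Suc n)
    have E: "((\<lambda>\<tau>. L * (K * exp (2 * L * \<tau>) / 2 ^ n)) has_integral 
        K * exp (2 * L * t) / 2 ^ Suc n - K * exp (2 * L * 0) / 2 ^ Suc n) {0..t}"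
    proof (rule fundamental_theorem_of_calculus)
      fix x show "((\<lambda>a. K * exp (2 * L * a) / 2 ^ Suc n) has_vector_derivative
         L * (K * exp (2 * L * x) / 2 ^ n)) (at x within {0..t})"
        unfolding has_real_derivative_iff_has_vector_derivative[symmetric]
        by (auto intro!: derivative_eq_intros simp: field_simps)
    qed (use Suc in auto)
    have "norm (integral {0..t} (\<lambda>\<tau>. f \<tau> (p (Suc n) \<tau>) - f \<tau> (p n \<tau>))) \<le> 
       integral {0..t} (\<lambda>\<tau>. L * (K * exp (2 * L * \<tau>) / 2 ^ n))"
    proof (rule Henstock_Kurzweil_Integration.integral_norm_bound_integral)
      fix \<tau> assume t: "\<tau> \<in> {0..t}"
      then have \<tau>: "\<tau> \<in> {0..T}" using Suc by auto
      have "\<bar>f \<tau> (p (Suc n) \<tau>) - f \<tau> (p n \<tau>)\<bar> \<le> L * \<bar>p (Suc n) \<tau> - p n \<tau>\<bar>" by (rule lip[OF \<tau>])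
      also have "\<dots> \<le> L * (K * exp (2 * L * \<tau>) / 2 ^ n)"
        using Suc.IH[OF \<tau>] L by (intro mult_left_mono) auto
      finally show "norm (f \<tau> (p (Suc n) \<tau>) - f \<tau> (p n \<tau>)) \<le> L * (K * exp (2 * L * \<tau>) / 2 ^ n)"
        by simp
    qed (intro integrable_diff int cp Suc, rule has_integral_integrable[OF E])
    also have "\<dots> \<le> K * exp (2 * L * t) / 2 ^ Suc n"
      unfolding integral_unique[OF E] using K by simp
    also have "integral {0..t} (\<lambda>\<tau>. f \<tau> (p (Suc n) \<tau>) - f \<tau> (p n \<tau>)) = 
       integral {0..t} (\<lambda>\<tau>. f \<tau> (p (Suc n) \<tau>)) - integral {0..t} (\<lambda>\<tau>. f \<tau> (p n \<tau>))"
      by (intro integral_diff int cp Suc)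
    also have "\<dots> = p (Suc (Suc n)) t - p (Suc n) t" by (simp add: pS)
    finally show ?case by simp
  qed
  define \<phi> where "\<phi> t = x0 + (\<Sum>n. p (Suc n) t - p n t)" for t
  have lim: "uniform_limit {0..T} p \<phi> sequentially"
  proof -
    have "uniform_limit {0..T} (\<lambda>n t. \<Sum>i<n. p (Suc i) t - p i t) (\<lambda>t. \<Sum>n. p (Suc n) t - p n t) sequentially"
    proof (rule Weierstrass_m_test)
      fix n t assume t: "t \<in> {0..T}"
      have "K * exp (2 * L * t) / 2 ^ n \<le> K * exp (2 * L * T) * (1 / 2) ^ n"
        using t K L by (auto simp: power_divide intro!: divide_right_mono mult_left_mono)
      with diff[OF t, of n] show "norm (p (Suc n) t - p n t) \<le> K * exp (2 * L * T) * (1 / 2) ^ n"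
        by simp
    qed (auto intro!: summable_mult summable_geometric)
    then have "uniform_limit {0..T} (\<lambda>n t. x0 + (\<Sum>i<n. p (Suc i) t - p i t)) \<phi> sequentially"
      unfolding \<phi>_def by (intro uniform_limit_intros)
    moreover have "x0 + (\<Sum>i<n. p (Suc i) t - p i t) = p n t" for n t
      by (subst sum_lessThan_telescope) (simp add: p0)
    ultimately show ?thesis by simp
  qed
  have c\<phi>: "continuous_on {0..T} \<phi>"
    by (rule uniform_limit_theorem[OF _ lim]) (auto simp: cp)
  have eq: "\<phi> t = x0 + integral {0..t} (\<lambda>\<tau>. f \<tau> (\<phi> \<tau>))" if t: "t \<in> {0..T}" for t
  proof -
    have "uniform_limit {0..t} (\<lambda>n \<tau>. f \<tau> (p n \<tau>)) (\<lambda>\<tau>. f \<tau> (\<phi> \<tau>)) sequentially"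
    proof (rule uniform_limitI)
      fix e :: real assume "e > 0"
      then have "e / L > 0" using L by simp
      from uniform_limitD[OF lim this]
      show "\<forall>\<^sub>F n in sequentially. \<forall>\<tau>\<in>{0..t}. dist (f \<tau> (p n \<tau>)) (f \<tau> (\<phi> \<tau>)) < e"
      proof eventually_elim
        case (elim n)
        show ?case
        proof
          fix \<tau> assume "\<tau> \<in> {0..t}"
          then have \<tau>: "\<tau> \<in> {0..T}" using t by auto
          have "dist (p n \<tau>) (\<phi> \<tau>) < e / L" using elim \<tau> by blast
          then have "L * \<bar>p n \<tau> - \<phi> \<tau>\<bar> < e" using L by (simp add: dist_real_def field_simps)
          with lip[OF \<tau>, of "p n \<tau>" "\<phi> \<tau>"] show "dist (f \<tau> (p n \<tau>)) (f \<tau> (\<phi> \<tau>)) < e"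
            by (simp add: dist_real_def)
        qed
      qed
    qed
    then obtain I J where IJ: "\<And>n. ((\<lambda>\<tau>. f \<tau> (p n \<tau>)) has_integral I n) {0..t}"
      "((\<lambda>\<tau>. f \<tau> (\<phi> \<tau>)) has_integral J) {0..t}" "I \<longlonglongrightarrow> J"
      by (rule uniform_limit_integral) 
         (use continuous_on_subset[OF comp[OF cp]] t in auto)
    have "p (Suc n) t = x0 + I n" for n using IJ(1)[of n] by (simp add: pS integral_unique)
    then have "(\<lambda>n. p (Suc n) t) \<longlonglongrightarrow> x0 + J" using IJ(3) by (auto intro!: tendsto_intros)
    moreover have "(\<lambda>n. p (Suc n) t) \<longlonglongrightarrow> \<phi> t"
      using tendsto_uniform_limitI[OF lim t] by (rule LIMSEQ_Suc)
    ultimately show ?thesis using IJ(2) LIMSEQ_unique by (force simp: integral_unique)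
  qed
  show thesis
  proof (rule that)
    show "\<phi> 0 = x0" using eq[of 0] T by simp
    fix t assume t: "t \<in> {0..T}"
    have "((\<lambda>t. x0 + integral {0..t} (\<lambda>\<tau>. f \<tau> (\<phi> \<tau>))) has_real_derivative f t (\<phi> t)) (at t within {0..T})"
      using integral_has_real_derivative[OF comp[OF c\<phi>] t] by (auto intro!: derivative_eq_intros)
    then show "(\<phi> has_real_derivative f t (\<phi> t)) (at t within {0..T})"
      unfolding has_field_derivative_def by (rule has_derivative_transform[OF t, rotated]) (simp add: eq)
  qed
qed

text \<open>
  The function \<open>W\<close> is differentiable at \<open>(t, \<psi>(t))\<close> because its \<open>t\<close>-derivative exists at this point and
  its \<open>x\<close>-derivative is jointly continuous nearby.
\<close>
lemma partials_chain_rule: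
  fixes W w :: "real \<Rightarrow> real \<Rightarrow> real"
  assumes W_t: "((\<lambda>\<tau>. W \<tau> (\<psi> t)) has_real_derivative Wt) (at t)"
    and W_x: "\<And>\<tau> x. \<tau> \<in> {a<..<b} \<Longrightarrow> (W \<tau> has_real_derivative w \<tau> x) (at x)"
    and w: "continuous_on ({a<..<b} \<times> UNIV) (\<lambda>(t, x). w t x)"
    and t: "t \<in> {a<..<b}" and \<psi>: "(\<psi> has_real_derivative \<psi>') (at t)"
  shows "((\<lambda>\<tau>. W \<tau> (\<psi> \<tau>)) has_real_derivative Wt + w t (\<psi> t) * \<psi>') (at t)"
proof -
  have "((\<lambda>(x, y). W x y) has_derivative (\<lambda>(tx, ty). Wt * tx + blinfun_scaleR_left (w t (\<psi> t)) ty)) 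
     (at (t, \<psi> t) within {a<..<b} \<times> UNIV)"
  proof (rule has_derivative_partialsI)
    show "((\<lambda>x. W x (\<psi> t)) has_derivative (*) Wt) (at t within {a<..<b})"
      using W_t unfolding has_field_derivative_def by (rule has_derivative_at_withinI)
    show "(W x has_derivative blinfun_scaleR_left (w x y)) (at y within UNIV)" if "x \<in> {a<..<b}" for x y
    proof -
      have "blinfun_apply (blinfun_scaleR_left (w x y)) = (*) (w x y)" by (auto simp: fun_eq_iff)
      then show ?thesis using W_x[OF that, of y] by (simp only: has_field_derivative_def)
    qed
    have "continuous_on ({a<..<b} \<times> UNIV) (\<lambda>p. blinfun_scaleR_left (case p of (t, x) \<Rightarrow> w t x))"
      using w by (rule bounded_linear.continuous_on[OF bounded_linear_blinfun_scaleR_left])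
    then show "continuous (at (t, \<psi> t) within {a<..<b} \<times> UNIV) (\<lambda>(x, y). blinfun_scaleR_left (w x y))"
      using t by (auto simp: continuous_on_eq_continuous_within case_prod_unfold)
  qed auto
  then have "((\<lambda>(x, y). W x y) has_derivative (\<lambda>(tx, ty). Wt * tx + ty * w t (\<psi> t))) (at (t, \<psi> t))"
    using t by (subst (asm) at_within_open) (auto simp: open_Times)
  moreover have "((\<lambda>\<tau>. (\<tau>, \<psi> \<tau>)) has_derivative (\<lambda>h. (h, \<psi>' * h))) (at t)"
    using \<psi> unfolding has_field_derivative_def by (intro derivative_intros)
  ultimately have "((\<lambda>\<tau>. W \<tau> (\<psi> \<tau>)) has_derivative (\<lambda>h. Wt * h + (\<psi>' * h) * w t (\<psi> t))) (at t)"
    using has_derivative_compose[of "\<lambda>\<tau>. (\<tau>, \<psi> \<tau>)" _ t UNIV "\<lambda>(x, y). W x y"] by fastforce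
  moreover have "(\<lambda>h. Wt * h + (\<psi>' * h) * w t (\<psi> t)) = (*) (Wt + w t (\<psi> t) * \<psi>')"
    by (auto simp: fun_eq_iff algebra_simps)
  ultimately show ?thesis by (simp only: has_field_derivative_def)
qed

lemma mean_value_bound:
  fixes g :: "real \<Rightarrow> real"
  assumes "\<And>x. (g has_real_derivative g' x) (at x)" "\<epsilon> > 0" 
    "\<And>x. x \<in> {y..y + \<epsilon>} \<Longrightarrow> \<bar>g' x\<bar> \<le> B"
  shows "\<bar>(g (y + \<epsilon>) - g y) / \<epsilon>\<bar> \<le> B"
proof -
  obtain z where "z > y" "z < y + \<epsilon>" "g (y + \<epsilon>) - g y = (y + \<epsilon> - y) * g' z"
    using MVT2[of y "y + \<epsilon>" g g'] assms by auto
  then show ?thesis using assms(2,3) by auto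
qed

text \<open>
  Suppose that \<open>W\<^sub>t + u W\<^sub>x = F\<close>.  Formally, differentiation in \<open>x\<close> gives \<open>w\<^sub>t + u w\<^sub>x = F\<^sub>x - u\<^sub>x w\<close> for
  \<open>w = W\<^sub>x\<close>, hence an equation for \<open>w\<close> along characteristics; but \<open>w\<close> need not be differentiable.
  Therefore the average of \<open>w\<close> over a window \<open>[\<phi>(t), \<phi>(t) + \<epsilon>]\<close> of fixed width that travels with the
  characteristic is considered.  It is the difference quotient of \<open>W\<close>, it is differentiable in time
  with derivative
  \<open>(F(\<phi>+\<epsilon>) - F(\<phi>)) / \<epsilon> - w(\<phi>+\<epsilon>) (u(\<phi>+\<epsilon>) - u(\<phi>)) / \<epsilon>\<close>,
  and dominated convergence as \<open>\<epsilon> \<rightarrow> 0\<close> yields the equation for \<open>w\<close> in integrated form.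
\<close>
lemma transport_along_characteristic:
  fixes u v w f W F :: "real \<Rightarrow> real \<Rightarrow> real" and \<phi> :: "real \<Rightarrow> real"
  assumes T: "0 \<le> T"
    and v: "continuous_on ({0..T} \<times> UNIV) (\<lambda>(t, x). v t x)"
    and w: "continuous_on ({0..T} \<times> UNIV) (\<lambda>(t, x). w t x)"
    and f: "continuous_on ({0..T} \<times> UNIV) (\<lambda>(t, x). f t x)"
    and u_x: "\<And>t x. t \<in> {0..T} \<Longrightarrow> (u t has_real_derivative v t x) (at x)"
    and W_x: "\<And>t x. t \<in> {0..T} \<Longrightarrow> (W t has_real_derivative w t x) (at x)"
    and F_x: "\<And>t x. t \<in> {0..T} \<Longrightarrow> (F t has_real_derivative f t x) (at x)"
    and W_t: "\<And>t x. t \<in> {0<..<T} \<Longrightarrow> ((\<lambda>\<tau>. W \<tau> x) has_real_derivative F t x - u t x * w t x) (at t)"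
    and \<phi>: "\<And>t. t \<in> {0..T} \<Longrightarrow> (\<phi> has_real_derivative u t (\<phi> t)) (at t within {0..T})"
  shows "((\<lambda>t. f t (\<phi> t) - w t (\<phi> t) * v t (\<phi> t)) has_integral w T (\<phi> T) - w 0 (\<phi> 0)) {0..T}"
proof -
  define \<epsilon> :: "nat \<Rightarrow> real" where "\<epsilon> k = 1 / real (Suc k)" for k
  have \<epsilon>: "\<epsilon> k > 0" "\<epsilon> k \<le> 1" for k by (auto simp: \<epsilon>_def)
  have \<epsilon>0: "\<epsilon> \<longlonglongrightarrow> 0" unfolding \<epsilon>_def using LIMSEQ_inverse_real_of_nat by (simp add: inverse_eq_divide)
  then have \<epsilon>at: "filterlim \<epsilon> (at 0) sequentially"
    unfolding filterlim_at using \<epsilon>(1) by (auto intro!: always_eventually simp: less_imp_neq[symmetric])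
  have c\<phi>: "continuous_on {0..T} \<phi>" using \<phi> by (rule DERIV_continuous_on)
  have comp: "continuous_on {0..T} (\<lambda>t. g t (\<phi> t + c))"
    if "continuous_on ({0..T} \<times> UNIV) (\<lambda>(t, x). g t x)" for g :: "real \<Rightarrow> real \<Rightarrow> real" and c
    by (intro continuous_on_along[OF that] continuous_intros c\<phi>)
  define A where "A k t = (W t (\<phi> t + \<epsilon> k) - W t (\<phi> t)) / \<epsilon> k" for k t
  define g where "g k t = (F t (\<phi> t + \<epsilon> k) - F t (\<phi> t)) / \<epsilon> k 
      - w t (\<phi> t + \<epsilon> k) * ((u t (\<phi> t + \<epsilon> k) - u t (\<phi> t)) / \<epsilon> k)" for k t
  have int: "(g k has_integral A k T - A k 0) {0..T}" for k
  proof (rule fundamental_theorem_of_calculus_interior[OF T])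
    \<comment> \<open>The window average as a parameter integral of \<open>w\<close>, which is continuous in time up to the end points.\<close>
    have win: "W t (\<phi> t + \<epsilon> k) - W t (\<phi> t) = integral {0..\<epsilon> k} (\<lambda>y. w t (\<phi> t + y))" if "t \<in> {0..T}" for t
    proof -
      have "((\<lambda>y. w t (\<phi> t + y)) has_integral W t (\<phi> t + \<epsilon> k) - W t (\<phi> t + 0)) {0..\<epsilon> k}"
      proof (rule fundamental_theorem_of_calculus)
        fix y
        have "((\<lambda>y. W t (\<phi> t + y)) has_real_derivative w t (\<phi> t + y)) (at y)"
          using W_x[OF that, of "\<phi> t + y"] by (simp add: DERIV_shift add.commute)
        then show "((\<lambda>y. W t (\<phi> t + y)) has_vector_derivative w t (\<phi> t + y)) (at y within {0..\<epsilon> k})"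
          unfolding has_real_derivative_iff_has_vector_derivative by (rule has_vector_derivative_at_within)
      qed (use \<epsilon> less_imp_le in blast)
      then show ?thesis by (simp add: integral_unique)
    qed
    have cint: "continuous_on {0..T} (\<lambda>t. integral (cbox 0 (\<epsilon> k)) (\<lambda>y. w t (\<phi> t + y)))"
    proof (rule integral_continuous_on_param)
      show "continuous_on ({0..T} \<times> cbox 0 (\<epsilon> k)) (\<lambda>(t, y). w t (\<phi> t + y))"
      proof -
        have 1: "continuous_on ({0..T} \<times> cbox 0 (\<epsilon> k)) (\<lambda>p. \<phi> (fst p) + snd p)"
          by (intro continuous_on_add continuous_on_snd continuous_on_id
                continuous_on_compose2[OF c\<phi> continuous_on_fst[OF continuous_on_id]]) auto
        have "continuous_on ({0..T} \<times> cbox 0 (\<epsilon> k)) (\<lambda>p. case (fst p, \<phi> (fst p) + snd p) of (t, x) \<Rightarrow> w t x)"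
          by (rule continuous_on_compose2[OF w continuous_on_Pair[OF continuous_on_fst[OF continuous_on_id] 1]]) auto
        then show ?thesis by (simp add: case_prod_unfold)
      qed
    qed
    have "continuous_on {0..T} (\<lambda>t. W t (\<phi> t + \<epsilon> k) - W t (\<phi> t))"
      by (rule continuous_on_eq[OF cint]) (simp add: win)
    then show "continuous_on {0..T} (A k)"
      unfolding A_def using \<epsilon>(1)[of k] by (intro continuous_on_divide continuous_on_const) auto
    fix t assume t: "t \<in> {0<..<T}"
    have \<phi>t: "(\<phi> has_real_derivative u t (\<phi> t)) (at t)"
      using \<phi>[of t] t by (auto simp: at_within_Icc_at)
    have chain: "((\<lambda>\<tau>. W \<tau> (\<phi> \<tau> + c)) has_real_derivative 
       (F t (\<phi> t + c) - u t (\<phi> t + c) * w t (\<phi> t + c)) + w t (\<phi> t + c) * u t (\<phi> t)) (at t)" for c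
      by (rule partials_chain_rule[of W "\<lambda>\<tau>. \<phi> \<tau> + c" t _ 0 T])
         (use t in \<open>auto intro!: W_t W_x continuous_on_subset[OF w] derivative_eq_intros \<phi>t\<close>)
    have "(A k has_real_derivative g k t) (at t)"
      unfolding A_def
      by (rule DERIV_cong, rule DERIV_cdivide[OF DERIV_diff[OF chain[of "\<epsilon> k"] chain[of 0, simplified]]])
         (simp add: g_def diff_divide_distrib add_divide_distrib algebra_simps)
    then show "(A k has_vector_derivative g k t) (at t)"
      by (simp add: has_real_derivative_iff_has_vector_derivative)
  qed
  obtain B where B: "\<And>t x. t \<in> {0..T} \<Longrightarrow> x \<in> {\<phi> t..\<phi> t + 1} \<Longrightarrow> \<bar>v t x\<bar> \<le> B \<and> \<bar>w t x\<bar> \<le> B \<and> \<bar>f t x\<bar> \<le> B"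
  proof -
    have "compact (\<phi> ` {0..T})" by (intro compact_continuous_image c\<phi> compact_Icc)
    then obtain R where R: "\<And>t. t \<in> {0..T} \<Longrightarrow> \<bar>\<phi> t\<bar> \<le> R"
      unfolding bounded_pos[symmetric] by (force dest!: compact_imp_bounded simp: bounded_pos)
    let ?S = "{0..T} \<times> {-R..R + 1}"
    have b: "\<exists>B. \<forall>t\<in>{0..T}. \<forall>x\<in>{-R..R+1}. \<bar>h t x\<bar> \<le> B"
      if "continuous_on ({0..T} \<times> UNIV) (\<lambda>(t, x). h t x)" for h :: "real \<Rightarrow> real \<Rightarrow> real"
    proof -
      have "compact ((\<lambda>(t, x). h t x) ` ?S)"
        by (intro compact_continuous_image continuous_on_subset[OF that] compact_Times compact_Icc) auto
      then obtain B where "\<forall>z\<in>(\<lambda>(t, x). h t x) ` ?S. norm z \<le> B"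
        using compact_imp_bounded bounded_iff by blast
      then show ?thesis by (intro exI[of _ B]) auto
    qed
    obtain B1 B2 B3 where B: "\<forall>t\<in>{0..T}. \<forall>x\<in>{-R..R+1}. \<bar>v t x\<bar> \<le> B1"
      "\<forall>t\<in>{0..T}. \<forall>x\<in>{-R..R+1}. \<bar>w t x\<bar> \<le> B2" "\<forall>t\<in>{0..T}. \<forall>x\<in>{-R..R+1}. \<bar>f t x\<bar> \<le> B3"
      using b[OF v] b[OF w] b[OF f] by blast
    show thesis
    proof (rule that[of "max B1 (max B2 B3)"])
      fix t x assume t: "t \<in> {0..T}" and x: "x \<in> {\<phi> t..\<phi> t + 1}"
      then have "x \<in> {-R..R+1}" using R[OF t] by auto
      with B t show "\<bar>v t x\<bar> \<le> max B1 (max B2 B3) \<and> \<bar>w t x\<bar> \<le> max B1 (max B2 B3) \<and> \<bar>f t x\<bar> \<le> max B1 (max B2 B3)"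
        by (meson le_max_iff_disj)
    qed
  qed
  have quot: "(\<lambda>k. (G (y + \<epsilon> k) - G y) / \<epsilon> k) \<longlonglongrightarrow> G'" 
    if "(G has_real_derivative G') (at y)" for G G' y
    using that unfolding DERIV_def by (rule filterlim_compose[OF _ \<epsilon>at])
  show ?thesis
  proof (rule has_integral_dominated_convergence[OF int])
    show "(\<lambda>_. B + B * B) integrable_on {0..T}"
      by (intro integrable_continuous_real continuous_on_const)
    show "\<forall>t\<in>{0..T}. norm (g k t) \<le> B + B * B" for k
    proof
      fix t assume t: "t \<in> {0..T}"
      have sub: "{\<phi> t..\<phi> t + \<epsilon> k} \<subseteq> {\<phi> t..\<phi> t + 1}" using \<epsilon>(2)[of k] by auto
      have 1: "\<bar>(F t (\<phi> t + \<epsilon> k) - F t (\<phi> t)) / \<epsilon> k\<bar> \<le> B"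
        by (rule mean_value_bound[OF F_x[OF t] \<epsilon>(1)]) (use B[OF t] sub in blast)
      have 2: "\<bar>(u t (\<phi> t + \<epsilon> k) - u t (\<phi> t)) / \<epsilon> k\<bar> \<le> B"
        by (rule mean_value_bound[OF u_x[OF t] \<epsilon>(1)]) (use B[OF t] sub in blast)
      have 3: "\<bar>w t (\<phi> t + \<epsilon> k)\<bar> \<le> B" using B[OF t, of "\<phi> t + \<epsilon> k"] \<epsilon>[of k] by auto
      have "\<bar>w t (\<phi> t + \<epsilon> k) * ((u t (\<phi> t + \<epsilon> k) - u t (\<phi> t)) / \<epsilon> k)\<bar> \<le> B * B"
        unfolding abs_mult by (intro mult_mono 2 3) (use 3 in auto)
      then show "norm (g k t) \<le> B + B * B" unfolding g_def using 1 by (simp only: real_norm_def)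
    qed
    show "\<forall>t\<in>{0..T}. (\<lambda>k. g k t) \<longlonglongrightarrow> f t (\<phi> t) - w t (\<phi> t) * v t (\<phi> t)"
    proof
      fix t assume t: "t \<in> {0..T}"
      have "continuous_on UNIV (w t)"
      proof -
        have "continuous_on UNIV (\<lambda>x. case (t, x) of (t, x) \<Rightarrow> w t x)"
          by (rule continuous_on_compose2[OF w]) (use t in \<open>auto intro!: continuous_intros\<close>)
        then show ?thesis by simp
      qed
      then have "isCont (w t) (\<phi> t + 0)" by (simp add: continuous_on_eq_continuous_at)
      then have "(\<lambda>k. w t (\<phi> t + \<epsilon> k)) \<longlonglongrightarrow> w t (\<phi> t + 0)"
        by (rule isCont_tendsto_compose) (intro tendsto_intros \<epsilon>0)
      then show "(\<lambda>k. g k t) \<longlonglongrightarrow> f t (\<phi> t) - w t (\<phi> t) * v t (\<phi> t)"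
        unfolding g_def by (intro tendsto_diff tendsto_mult quot F_x u_x t) simp
    qed
    show "(\<lambda>k. A k T - A k 0) \<longlonglongrightarrow> w T (\<phi> T) - w 0 (\<phi> 0)"
      unfolding A_def by (intro tendsto_diff quot W_x) (use T in auto)
  qed
qed

section \<open>Two ordinary differential equations\<close>

lemma integral_equation_imp_derivative:
  fixes y g :: "real \<Rightarrow> real"
  assumes g: "continuous_on {0..T} g"
    and y: "\<And>t. t \<in> {0..T} \<Longrightarrow> (g has_integral y t - y 0) {0..t}" and t: "t \<in> {0..T}"
  shows "(y has_real_derivative g t) (at t within {0..T})"
proof -
  have eq: "y s = y 0 + integral {0..s} g" if "s \<in> {0..T}" for s
    using integral_unique[OF y[OF that]] by simp
  have "((\<lambda>t. y 0 + integral {0..t} g) has_real_derivative g t) (at t within {0..T})"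
    using integral_has_real_derivative[OF g t] by (auto intro!: derivative_eq_intros)
  then show ?thesis
    unfolding has_field_derivative_def by (rule has_derivative_transform[OF t, rotated]) (rule eq)
qed

text \<open>
  The integrating factor turns \<open>r' = - r b\<close> into constancy of \<open>r exp(\<integral>b)\<close>.
\<close>
lemma linear_ode_zero:
  fixes r b :: "real \<Rightarrow> real"
  assumes b: "continuous_on {0..T} b"
    and r: "\<And>t. t \<in> {0..T} \<Longrightarrow> (r has_real_derivative - (r t * b t)) (at t within {0..T})"
    and 0: "r 0 = 0" and t: "t \<in> {0..T}"
  shows "r t = 0"
proof -
  have "\<exists>c. \<forall>t\<in>{0..T}. r t * exp (integral {0..t} b) = c"
  proof (rule has_field_derivative_zero_constant)
    fix t assume t: "t \<in> {0..T}"
    show "((\<lambda>t. r t * exp (integral {0..t} b)) has_real_derivative 0) (at t within {0..T})"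
      using r[OF t] integral_has_real_derivative[OF b t]
      by (auto intro!: derivative_eq_intros)
  qed auto
  then obtain c where c: "\<And>t. t \<in> {0..T} \<Longrightarrow> r t * exp (integral {0..t} b) = c" by blast
  from c[of 0] c[OF t] t 0 show ?thesis by auto
qed

text \<open>
  Along a solution of \<open>m' = - (m\<^sup>2 + c\<^sup>2) / 2\<close> the angle \<open>arctan(m / c)\<close> decreases at the constant rate
  \<open>c / 2\<close>.  Within time \<open>2\<pi> / c\<close> it would decrease by \<open>\<pi>\<close>, the length of the open interval in which
  it takes its values.
\<close>
lemma riccati_blowup:
  fixes m :: "real \<Rightarrow> real"
  assumes c: "c > 0" and T: "T \<ge> 2 * pi / c"
    and m: "\<And>t. t \<in> {0..T} \<Longrightarrow> (m has_real_derivative - ((m t)\<^sup>2 + c\<^sup>2) / 2) (at t within {0..T})"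
  shows False
proof -
  have "2 * pi / c \<ge> 0" using c by simp
  then have T0: "T \<ge> 0" using T by linarith
  have "\<exists>k. \<forall>t\<in>{0..T}. arctan (m t / c) + c * t / 2 = k"
  proof (rule has_field_derivative_zero_constant)
    fix t assume t: "t \<in> {0..T}"
    have pos: "c\<^sup>2 + (m t)\<^sup>2 > 0" using c by (simp add: add_pos_nonneg)
    define D where "D = (m t)\<^sup>2 + c\<^sup>2"
    have D: "D > 0" using pos by (simp add: D_def add.commute)
    have "1 + (m t / c)\<^sup>2 = D / c\<^sup>2"
      using c by (simp add: D_def power_divide add_divide_distrib)
    then have "(- D / 2 / c) * inverse (1 + (m t / c)\<^sup>2) + c / 2 = (- D / 2 / c) * (c\<^sup>2 / D) + c / 2"
      by simp
    also have "\<dots> = 0" using D c by (simp add: power2_eq_square)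
    finally have z: "(- D / 2 / c) * inverse (1 + (m t / c)\<^sup>2) + c / 2 = 0" .
    have 1: "((\<lambda>t. m t / c) has_real_derivative - D / 2 / c) (at t within {0..T})"
      using DERIV_cdivide[OF m[OF t], of c] by (simp add: D_def)
    have 2: "((\<lambda>t. c * t / 2) has_real_derivative c / 2) (at t within {0..T})"
      by (auto intro!: derivative_eq_intros)
    have 3: "((\<lambda>t. arctan (m t / c)) has_real_derivative (- D / 2 / c) * inverse (1 + (m t / c)\<^sup>2)) (at t within {0..T})"
      using DERIV_chain2[OF DERIV_arctan 1] by (simp add: mult.commute)
    show "((\<lambda>t. arctan (m t / c) + c * t / 2) has_real_derivative 0) (at t within {0..T})"
      using DERIV_add[OF 3 2] unfolding z .
  qed auto
  then obtain k where k: "\<And>t. t \<in> {0..T} \<Longrightarrow> arctan (m t / c) + c * t / 2 = k" by blast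
  have "c * T / 2 \<ge> pi" using T c by (simp add: field_simps)
  then show False
    using k[of 0] k[of T] T0 arctan_ubound[of "m 0 / c"] arctan_lbound[of "m T / c"] by auto
qed

section \<open>The continuity equation in integrated form\<close>

lemma inv_dx_has_derivative:
  assumes g: "continuous_on UNIV g"
  shows "(inv_dx g has_real_derivative g x) (at x)"
proof -
  define b where "b = \<bar>x\<bar> + 1"
  have "((\<lambda>u. LBINT y=ereal 0..ereal u. g y) has_vector_derivative g x) (at x within {-b..b})"
    by (rule interval_integral_FTC2) (auto simp: b_def intro: continuous_on_subset[OF g])
  moreover have "at x within {-b..b} = at x" by (rule at_within_Icc_at) (auto simp: b_def)
  moreover have "inv_dx g = (\<lambda>u. LBINT y=ereal 0..ereal u. g y)"
    by (rule ext) (simp only: inv_dx_def zero_ereal_def)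
  ultimately show ?thesis
    by (simp only: has_real_derivative_iff_has_vector_derivative)
qed

lemma inv_dx_0 [simp]: "inv_dx g 0 = 0"
  by (simp only: inv_dx_def zero_ereal_def interval_integral_endpoints_same)

text \<open>
  The span of \<open>cos(c x)\<close> and \<open>sin(c x)\<close> is invariant under differentiation, which makes trigonometric
  functions smooth in the sense required of test functions.
\<close>
lemma funpow_deriv_trig:
  "\<exists>A' B'. (deriv ^^ k) (\<lambda>x. A * cos (c * x) + B * sin (c * x)) = (\<lambda>x. A' * cos (c * x) + B' * sin (c * x))"
proof (induction k arbitrary: A B)
  case (Suc k)
  have "deriv (\<lambda>x. A * cos (c * x) + B * sin (c * x)) = (\<lambda>x. (B * c) * cos (c * x) + (- A * c) * sin (c * x))"
    by (intro ext DERIV_imp_deriv) (auto intro!: derivative_eq_intros)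
  with Suc[of "B * c" "- A * c"] show ?case by (simp only: funpow_Suc_right o_apply)
qed auto

lemma test_function_trig: "test_function (\<lambda>x. A * cos (2 * pi * of_int n * x) + B * sin (2 * pi * of_int n * x))"
  unfolding test_function_def periodic1_def
proof (intro conjI allI)
  fix x :: real
  have "cis (2 * pi * of_int n * (x + 1)) = cis (2 * pi * of_int n * x) * cis (2 * pi * of_int n)"
    by (simp add: cis_mult algebra_simps)
  then have "cis (2 * pi * of_int n * (x + 1)) = cis (2 * pi * of_int n * x)" by simp
  then have "cos (2 * pi * of_int n * (x + 1)) = cos (2 * pi * of_int n * x)" 
    "sin (2 * pi * of_int n * (x + 1)) = sin (2 * pi * of_int n * x)"
    by (simp_all add: complex_eq_iff)
  then show "A * cos (2 * pi * of_int n * (x + 1)) + B * sin (2 * pi * of_int n * (x + 1)) =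
     A * cos (2 * pi * of_int n * x) + B * sin (2 * pi * of_int n * x)" by (simp only:)
  fix k
  obtain A' B' where eq: "(deriv ^^ k) (\<lambda>x. A * cos (2 * pi * of_int n * x) + B * sin (2 * pi * of_int n * x))
     = (\<lambda>x. A' * cos (2 * pi * of_int n * x) + B' * sin (2 * pi * of_int n * x))"
    using funpow_deriv_trig by blast
  show "(deriv ^^ k) (\<lambda>x. A * cos (2 * pi * of_int n * x) + B * sin (2 * pi * of_int n * x)) differentiable at x"
  proof -
    have "((\<lambda>x. A' * cos (2 * pi * of_int n * x) + B' * sin (2 * pi * of_int n * x)) has_real_derivative
       - A' * sin (2 * pi * of_int n * x) * (2 * pi * of_int n) 
       + B' * cos (2 * pi * of_int n * x) * (2 * pi * of_int n)) (at x)"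
      by (auto intro!: derivative_eq_intros)
    then show ?thesis unfolding eq has_field_derivative_def by (rule differentiableI)
  qed
qed

lemma fourier_coeff_cos_sin:
  assumes "set_integrable lborel {0..1} g"
  shows "fourier_coeff g n = Complex (LINT x:{0..1}|lborel. g x * cos (2 * pi * of_int n * x))
      (- (LINT x:{0..1}|lborel. g x * sin (2 * pi * of_int n * x)))"
proof (rule complex_eqI)
  note i = fourier_integrable[OF assms, of n, unfolded set_integrable_def]
  show "Re (fourier_coeff g n) = Re (Complex (LINT x:{0..1}|lborel. g x * cos (2 * pi * of_int n * x))
      (- (LINT x:{0..1}|lborel. g x * sin (2 * pi * of_int n * x))))"
    unfolding fourier_coeff_def set_lebesgue_integral_def
    by (subst integral_Re[symmetric, OF i]) simp
  show "Im (fourier_coeff g n) = Im (Complex (LINT x:{0..1}|lborel. g x * cos (2 * pi * of_int n * x))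
      (- (LINT x:{0..1}|lborel. g x * sin (2 * pi * of_int n * x))))"
    unfolding fourier_coeff_def set_lebesgue_integral_def
    by (subst integral_Im[symmetric, OF i]) simp
qed

text \<open>
  Testing against a cosine and a sine gives the real and the imaginary part of the coefficient.
\<close>
lemma fourier_coeff_weak_deriv:
  assumes "weak_deriv f q"
  shows "fourier_coeff q n = 2 * pi * of_int n * \<i> * fourier_coeff f n"
proof -
  let ?c = "2 * pi * of_int n :: real"
  have int: "set_integrable lborel {0..1} f" "set_integrable lborel {0..1} q"
    and w: "\<And>\<phi>. test_function \<phi> \<Longrightarrow>
       (LINT x:{0..1}|lborel. f x * deriv \<phi> x) = - (LINT x:{0..1}|lborel. q x * \<phi> x)"
    using assms by (auto simp: weak_deriv_def)
  have "deriv (\<lambda>x. 1 * cos (?c * x) + 0 * sin (?c * x)) = (\<lambda>x. - ?c * sin (?c * x))"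
    "deriv (\<lambda>x. 0 * cos (?c * x) + 1 * sin (?c * x)) = (\<lambda>x. ?c * cos (?c * x))"
    by (intro ext DERIV_imp_deriv; auto intro!: derivative_eq_intros)+
  with w[OF test_function_trig[of 1 n 0]] w[OF test_function_trig[of 0 n 1]]
  have c: "(LINT x:{0..1}|lborel. f x * (- ?c * sin (?c * x))) = - (LINT x:{0..1}|lborel. q x * cos (?c * x))"
    and s: "(LINT x:{0..1}|lborel. f x * (?c * cos (?c * x))) = - (LINT x:{0..1}|lborel. q x * sin (?c * x))"
    by simp_all
  have "(LINT x:{0..1}|lborel. f x * (a * h x)) = a * (LINT x:{0..1}|lborel. f x * h x)" for a h
    unfolding set_integral_mult_right[symmetric] by (simp add: mult_ac)
  with c s show ?thesis
    unfolding fourier_coeff_cos_sin[OF int(1)] fourier_coeff_cos_sin[OF int(2)]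
    by (simp only:) (simp add: complex_eq_iff)
qed

lemma set_integrable_sobolev: "g \<in> sobolev r \<Longrightarrow> set_integrable lborel {0..1} g"
  by (rule set_integrable_of_square) (auto simp: sobolev_def)

lemma fourier_coeff_AE_opposite:
  assumes "set_integrable lborel {0..1} f" "set_integrable lborel {0..1} q"
    "AE x in lborel. f x + q x = 0"
  shows "fourier_coeff f n = - fourier_coeff q n"
proof -
  have "fourier_coeff f n + fourier_coeff q n =
      (LINT x:{0..1}|lborel. of_real (f x) * cis (- (2 * pi * of_int n * x))
         + of_real (q x) * cis (- (2 * pi * of_int n * x)))"
    unfolding fourier_coeff_def
    by (rule set_integral_add(2)[symmetric]) (intro fourier_integrable assms)+
  also have "\<dots> = 0"
    unfolding set_lebesgue_integral_def
    by (rule integral_eq_zero_AE) 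
       (use assms(3) in \<open>auto elim!: eventually_mono simp flip: distrib_right of_real_add\<close>)
  finally show ?thesis by (simp add: eq_neg_iff_add_eq_0)
qed

text \<open>
  The continuity equation \<open>\<rho>\<^sub>t + g\<^sub>x = 0\<close> for the flux \<open>g\<close> is known only frequency by frequency.  Its
  antiderivative in \<open>x\<close> is a classical identity between continuous functions.  To prove it, the equation is
  first integrated in time: the function
  \<open>\<integral>\<^sub>0\<^sup>x (\<rho>(s) - \<rho>(0)) + \<integral>\<^sub>0\<^sup>s g(t, x) dt\<close>
  is continuous and periodic in \<open>x\<close>, and its Fourier coefficients at nonzero frequencies vanish, so it does
  not depend on \<open>x\<close>.  Working with time integrals confines the interchange of integrals to
  continuous integrands.
\<close>
lemma density_potential_derivative:
  fixes \<rho> g :: "real \<Rightarrow> real \<Rightarrow> real"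
  assumes \<rho>: "continuous_on ({0..} \<times> UNIV) (\<lambda>(t, x). \<rho> t x)" "\<And>t x. t \<ge> 0 \<Longrightarrow> \<rho> t (x + 1) = \<rho> t x"
    and g: "continuous_on ({0..} \<times> UNIV) (\<lambda>(t, x). g t x)" "\<And>t x. t \<ge> 0 \<Longrightarrow> g t (x + 1) = g t x"
    and cont: "\<And>n. continuous_on {0..} (\<lambda>t. fourier_coeff (\<rho> t) n)"
    and deriv: "\<And>n t. t > 0 \<Longrightarrow> ((\<lambda>t. fourier_coeff (\<rho> t) n) has_vector_derivative 
        - (2 * pi * of_int n * \<i> * fourier_coeff (g t) n)) (at t)"
    and t: "t > 0"
  shows "((\<lambda>\<tau>. inv_dx (\<rho> \<tau>) x) has_real_derivative g t 0 - g t x) (at t)"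
proof -
  have slice: "continuous_on UNIV (h t)" if "continuous_on ({0..} \<times> UNIV) (\<lambda>(t, x). h t x)" "t \<ge> 0"
    for h :: "real \<Rightarrow> real \<Rightarrow> real" and t
  proof -
    have "continuous_on UNIV (\<lambda>x. case (t, x) of (t, x) \<Rightarrow> h t x)"
      by (rule continuous_on_compose2[OF that(1)]) (use that in \<open>auto intro!: continuous_intros\<close>)
    then show ?thesis by simp
  qed
  note c\<rho> = slice[OF \<rho>(1)] and cg = slice[OF g(1)]
  have cgt: "continuous_on {0..s} (\<lambda>t. g t x)" for x s
    using continuous_on_along[OF g(1), of "\<lambda>_. x"] by (rule continuous_on_subset) auto
  have id: "inv_dx (\<rho> s) x = inv_dx (\<rho> 0) x + integral {0..s} (\<lambda>t. g t 0 - g t x)" if s: "s \<ge> 0" for s x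
  proof -
    define J where "J x = inv_dx (\<rho> s) x - inv_dx (\<rho> 0) x" for x
    define I where "I x = integral {0..s} (\<lambda>t. g t x)" for x
    define \<delta> where "\<delta> x = \<rho> s x - \<rho> 0 x" for x
    have c\<delta>: "continuous_on UNIV \<delta>" unfolding \<delta>_def by (intro continuous_intros c\<rho> s order_refl)
    have J: "(J has_real_derivative \<delta> x) (at x)" for x
      unfolding J_def \<delta>_def by (intro DERIV_diff inv_dx_has_derivative c\<rho> s order_refl)
    have cJ: "continuous_on UNIV J" using J by (intro DERIV_continuous_on) auto
    have swap: "continuous_on (UNIV \<times> {0..s}) (\<lambda>(x, t). g t x)"
    proof -
      have "continuous_on (UNIV \<times> {0..s}) (\<lambda>p. case (snd p, fst p) of (t, x) \<Rightarrow> g t x)"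
        by (rule continuous_on_compose2[OF g(1)]) (auto intro!: continuous_intros)
      then show ?thesis by (simp add: case_prod_unfold)
    qed
    have cI: "continuous_on UNIV I" unfolding I_def
      using integral_continuous_on_param[of UNIV 0 s "\<lambda>x t. g t x"] swap by simp
    have \<delta>c: "cfourier (\<lambda>x. of_real (\<delta> x)) n = fourier_coeff (\<rho> s) n - fourier_coeff (\<rho> 0) n" for n
    proof -
      have sub: "continuous_on {0..1} (\<rho> s)" "continuous_on {0..1} (\<rho> 0)"
        using c\<rho>[of s] c\<rho>[of 0] s continuous_on_subset by blast+
      have "cfourier (\<lambda>x. of_real (\<delta> x)) n = cfourier (\<lambda>x. of_real (\<rho> s x)) n - cfourier (\<lambda>x. of_real (\<rho> 0 x)) n"
        unfolding cfourier_def \<delta>_def of_real_diff left_diff_distrib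
        by (intro integral_diff integrable_continuous_real continuous_intros sub)
      then show ?thesis using s by (simp add: fourier_coeff_eq_cfourier c\<rho>)
    qed
    have evol: "((\<lambda>t. - (2 * pi * of_int n * \<i> * fourier_coeff (g t) n)) has_integral 
        fourier_coeff (\<rho> s) n - fourier_coeff (\<rho> 0) n) {0..s}" for n
    proof (rule fundamental_theorem_of_calculus_interior[OF s])
      show "continuous_on {0..s} (\<lambda>t. fourier_coeff (\<rho> t) n)"
        by (rule continuous_on_subset[OF cont]) auto
    qed (rule deriv, simp)
    have fub: "integral {0..s} (\<lambda>t. fourier_coeff (g t) n) = cfourier (\<lambda>x. of_real (I x)) n" for n
    proof -
      \<comment> \<open>Fubini for the continuous integrand \<open>g(t, x) e\<^sub>n(x)\<close>.\<close>
      have "integral {0..s} (\<lambda>t. fourier_coeff (g t) n) = integral {0..s} (\<lambda>t. integral {0..1}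
          (\<lambda>x. of_real (g t x) * cis (- (2 * pi * of_int n * x))))"
        by (intro integral_cong) (simp add: fourier_coeff_eq_cfourier cg cfourier_def)
      also have "\<dots> = integral {0..1} (\<lambda>x. integral {0..s} (\<lambda>t. of_real (g t x) * cis (- (2 * pi * of_int n * x))))"
      proof -
        have "continuous_on ({0..s} \<times> {0..1}) (\<lambda>p. case p of (t, x) \<Rightarrow> g t x)"
          by (rule continuous_on_subset[OF g(1)]) auto
        then have "continuous_on ({0..s} \<times> {0..1}) (\<lambda>p. g (fst p) (snd p))"
          by (simp add: case_prod_unfold)
        then have "continuous_on ({0..s} \<times> {0..1}) (\<lambda>p. complex_of_real (g (fst p) (snd p)) * cis (- (2 * pi * of_int n * snd p)))"
          by (intro continuous_intros)
        then have "continuous_on (cbox (0, 0) (s, 1)) (\<lambda>(t, x). complex_of_real (g t x) * cis (- (2 * pi * of_int n * x)))"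
          by (simp add: cbox_Pair_eq case_prod_unfold)
        from integral_swap_continuous[OF this] show ?thesis by simp
      qed
      also have "\<dots> = cfourier (\<lambda>x. of_real (I x)) n"
        unfolding cfourier_def
      proof (rule integral_cong)
        fix x :: real
        have "integral {0..s} (\<lambda>t. complex_of_real (g t x)) = of_real (I x)"
          using integral_linear[OF integrable_continuous_real[OF cgt[of s x]] bounded_linear_of_real]
          by (simp add: I_def o_def)
        then show "integral {0..s} (\<lambda>t. of_real (g t x) * cis (- (2 * pi * of_int n * x)))
           = of_real (I x) * cis (- (2 * pi * of_int n * x))" by simp
      qed
      finally show ?thesis .
    qed
    have key: "cfourier (\<lambda>x. of_real (\<delta> x)) n = - (2 * pi * of_int n * \<i> * cfourier (\<lambda>x. of_real (I x)) n)" for n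
      using integral_unique[OF evol[of n]] fub[of n] \<delta>c[of n] by simp
    have Jv: "((\<lambda>x. complex_of_real (J x)) has_vector_derivative of_real (\<delta> x)) (at x)" for x
      using bounded_linear.has_vector_derivative[OF bounded_linear_of_real] J[of x]
      by (simp add: has_real_derivative_iff_has_vector_derivative)
    have \<delta>p: "complex_of_real (\<delta> (x + 1)) = of_real (\<delta> x)" for x using \<rho>(2) s by (simp add: \<delta>_def)
    note per = periodic_antiderivative[OF _ \<delta>p _ Jv]
    have c\<delta>': "continuous_on UNIV (\<lambda>x. complex_of_real (\<delta> x))" by (intro continuous_intros c\<delta>)
    have mean: "cfourier (\<lambda>x. of_real (\<delta> x)) 0 = 0" using key[of 0] by simp
    have Jper: "J (x + 1) = J x" for x using per(1)[OF c\<delta>' mean, of x] by simp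
    have Iper: "I (x + 1) = I x" for x
      unfolding I_def by (intro integral_cong) (auto intro: g(2))
    have sub: "continuous_on {0..1} J" "continuous_on {0..1} I"
      using cJ cI continuous_on_subset by blast+
    have z: "cfourier (\<lambda>x. of_real (J x + I x)) n = 0" if "n \<noteq> 0" for n
    proof -
      have split: "cfourier (\<lambda>x. of_real (J x + I x)) n = cfourier (\<lambda>x. of_real (J x)) n + cfourier (\<lambda>x. of_real (I x)) n"
        unfolding cfourier_def of_real_add distrib_right
        by (intro integral_add integrable_continuous_real continuous_intros sub)
      have cancel: "j + i = 0" if "a = X * j" "a = - (X * i)" "X \<noteq> 0" for a X i j :: complex
      proof -
        have "X * j + X * i = 0" using trans[OF that(1)[symmetric] that(2)] unfolding eq_neg_iff_add_eq_0 .
        then have "X * (j + i) = 0" by (simp only: distrib_left)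
        then show ?thesis using that(3) by simp
      qed
      show ?thesis
        unfolding split by (rule cancel[OF per(2)[OF c\<delta>' mean] key]) (use that in simp)
    qed
    have "complex_of_real (J x + I x) = cfourier (\<lambda>x. of_real (J x + I x)) 0" for x
      by (rule fourier_uniqueness_periodic[of "\<lambda>x. complex_of_real (J x + I x)", OF _ _ z])
         (intro continuous_intros cJ cI, simp add: Jper Iper)
    then have "complex_of_real (J x + I x) = complex_of_real (J 0 + I 0)" by metis
    then have "J x + I x = J 0 + I 0" by (simp only: of_real_eq_iff)
    then have "J x = I 0 - I x" by (simp add: J_def)
    also have "\<dots> = integral {0..s} (\<lambda>t. g t 0 - g t x)"
      unfolding I_def by (intro integral_diff[symmetric] integrable_continuous_real cgt)
    finally show ?thesis by (simp add: J_def)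
  qed
  have "((\<lambda>\<tau>. inv_dx (\<rho> 0) x + integral {0..\<tau>} (\<lambda>t. g t 0 - g t x)) has_real_derivative g t 0 - g t x)
      (at t within {0..t + 1})"
    using integral_has_real_derivative[OF continuous_on_diff[OF cgt[of "t+1" 0] cgt[of "t+1" x]], of t] t
    by (auto intro!: derivative_eq_intros)
  then have "((\<lambda>\<tau>. inv_dx (\<rho> \<tau>) x) has_real_derivative g t 0 - g t x) (at t within {0..t + 1})"
    unfolding has_field_derivative_def
    by (rule has_derivative_transform[rotated 2]) (use t in simp, rule id, simp)
  then show ?thesis using t by (simp add: at_within_Icc_at)
qed

section \<open>Blow-up\<close>

text \<open>
  The energy density is continuous and nonnegative, so its integral vanishes only if \<open>\<rho>\<^sub>0\<close> and the
  derivative of \<open>u\<^sub>0\<close> vanish identically.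
\<close>
lemma hs_const_neg:
  assumes u0: "u0 \<in> sobolev s" "s \<ge> 2" and \<rho>0: "\<rho>0 \<in> sobolev (s - 1)"
    and nt: "(\<exists>x. \<rho>0 x \<noteq> 0) \<or> \<not> (\<exists>c. \<forall>x. u0 x = c)"
  shows "hs_const 1 u0 \<rho>0 < 0"
proof -
  let ?e = "\<lambda>x. (\<rho>0 x)\<^sup>2 + (deriv u0 x)\<^sup>2"
  note du = sobolev_imp_C1[OF u0(2,1)]
  have per: "\<And>x. u0 (x + 1) = u0 x" "\<And>x. \<rho>0 (x + 1) = \<rho>0 x" and c\<rho>: "continuous_on UNIV \<rho>0"
    using assms by (auto simp: sobolev_def periodic1_def)
  have ce: "continuous_on UNIV ?e" by (intro continuous_intros c\<rho> du)
  then have ce1: "continuous_on {0..1} ?e" using continuous_on_subset by blast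
  have eq: "hs_const 1 u0 \<rho>0 = - (1/2) * integral {0..1} ?e"
    unfolding hs_const_def using borel_integrable_atLeastAtMost'[OF ce1]
    by (simp add: set_borel_integral_eq_integral(2))
  have nonneg: "integral {0..1} ?e \<ge> 0"
    by (rule integral_nonneg) (auto intro: integrable_continuous_real ce1)
  have "integral {0..1} ?e \<noteq> 0"
  proof
    assume "integral {0..1} ?e = 0"
    then have z: "\<forall>x\<in>{0..1}. ?e x = 0" by (subst (asm) integral_eq_0_iff[OF ce1]) auto
    have z1: "\<rho>0 x = 0" "deriv u0 x = 0" if "x \<in> {0..1}" for x
      using z that by (auto simp: sum_power2_eq_zero_iff)
    have fr: "frac x \<in> {0..1}" for x :: real by (simp add: frac_lt_1 less_imp_le)
    have r0: "\<rho>0 x = 0" for x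
      using z1(1)[OF fr[of x]] periodic_frac[of \<rho>0 x] per by simp
    have "\<exists>c. \<forall>x\<in>{0..1}. u0 x = c"
    proof (rule has_field_derivative_zero_constant)
      fix x :: real assume "x \<in> {0..1}"
      then have "(u0 has_real_derivative 0) (at x)" using du(1)[of x] z1(2) by simp
      then show "(u0 has_real_derivative 0) (at x within {0..1})" by (rule has_field_derivative_at_within)
    qed auto
    then have "\<exists>c. \<forall>x. u0 x = c" using fr periodic_frac[of u0] per(1) by metis
    with r0 nt show False by blast
  qed
  with nonneg eq show ?thesis by simp
qed

text \<open>
  The blow-up mechanism for classical data: \<open>P\<close> is a potential of \<open>\<rho>\<close>, and \<open>b(t)\<close> is the constant of
  integration in its evolution equation.  Both \<open>\<rho>\<close> (with potential \<open>P\<close>) and \<open>v = u\<^sub>x\<close> (with potential \<open>u\<close>)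
  satisfy a transport equation along the characteristic that starts at a zero of the initial density.
\<close>
lemma riccati_along_vacuum_characteristic:
  fixes u v \<rho> P F :: "real \<Rightarrow> real \<Rightarrow> real"
  assumes a: "a < 0" and T: "T = 2 * pi / sqrt (- 2 * a)"
    and cu: "continuous_on ({0..T} \<times> UNIV) (\<lambda>(t, x). u t x)"
    and cv: "continuous_on ({0..T} \<times> UNIV) (\<lambda>(t, x). v t x)"
    and c\<rho>: "continuous_on ({0..T} \<times> UNIV) (\<lambda>(t, x). \<rho> t x)"
    and v_per: "\<And>t x. t \<in> {0..T} \<Longrightarrow> v t (x + 1) = v t x"
    and u_x: "\<And>t x. t \<in> {0..T} \<Longrightarrow> (u t has_real_derivative v t x) (at x)"
    and F_x: "\<And>t x. t \<in> {0..T} \<Longrightarrow> 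
        (F t has_real_derivative (\<rho> t x)\<^sup>2 / 2 + (v t x)\<^sup>2 / 2 + a) (at x)"
    and u_t: "\<And>t x. t \<in> {0<..<T} \<Longrightarrow> ((\<lambda>\<tau>. u \<tau> x) has_real_derivative F t x - u t x * v t x) (at t)"
    and P_x: "\<And>t x. t \<in> {0..T} \<Longrightarrow> (P t has_real_derivative \<rho> t x) (at x)"
    and P_t: "\<And>t x. t \<in> {0<..<T} \<Longrightarrow> ((\<lambda>\<tau>. P \<tau> x) has_real_derivative b t - u t x * \<rho> t x) (at t)"
    and vac: "\<rho> 0 x0 = 0"
  shows False
proof -
  \<comment> \<open>With this \<open>c\<close> the equation \<open>m' = a - m\<^sup>2 / 2\<close> takes the form of the Riccati lemma.\<close>
  define c where "c = sqrt (- 2 * a)"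
  have c: "c > 0" "c\<^sup>2 = - 2 * a" using a by (auto simp: c_def)
  have T0: "0 \<le> T" using T c a by simp
  obtain L where L: "L > 0" "\<And>t x. t \<in> {0..T} \<Longrightarrow> \<bar>v t x\<bar> \<le> L"
  proof -
    have "compact ((\<lambda>(t, x). v t x) ` ({0..T} \<times> {0..1}))"
      by (intro compact_continuous_image continuous_on_subset[OF cv] compact_Times compact_Icc) auto
    then obtain L where L: "L > 0" "\<forall>z\<in>(\<lambda>(t, x). v t x) ` ({0..T} \<times> {0..1}). norm z \<le> L"
      using compact_imp_bounded bounded_pos by metis
    have "\<bar>v t x\<bar> \<le> L" if "t \<in> {0..T}" for t x
    proof -
      have "(t, frac x) \<in> {0..T} \<times> {0..1}" using that by (simp add: frac_lt_1 less_imp_le)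
      then have "norm (v t (frac x)) \<le> L" using L(2) by fast
      then show ?thesis using periodic_frac[of "v t" x] v_per[OF that] by simp
    qed
    with L(1) show thesis by (rule that)
  qed
  have lip: "\<bar>u t x - u t y\<bar> \<le> L * \<bar>x - y\<bar>" if "t \<in> {0..T}" for t x y
    using field_differentiable_bound[of UNIV "u t" "v t" L x y] u_x[OF that] L(2)[OF that] by simp
  obtain \<phi> where \<phi>: "\<phi> 0 = x0"
    "\<And>t. t \<in> {0..T} \<Longrightarrow> (\<phi> has_real_derivative u t (\<phi> t)) (at t within {0..T})"
    using picard_lindelof_strip[OF T0 cu L(1) lip] by blast
  have c\<phi>: "continuous_on {0..T} \<phi>" using \<phi>(2) by (rule DERIV_continuous_on)
  have \<phi>': "(\<phi> has_real_derivative u s (\<phi> s)) (at s within {0..t})" 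
    if "s \<in> {0..t}" "t \<in> {0..T}" for s t
    by (rule DERIV_subset[OF \<phi>(2)]) (use that in auto)
  have sub: "continuous_on ({0..t} \<times> UNIV) (\<lambda>(t, x). h t x)" 
    if "continuous_on ({0..T} \<times> UNIV) (\<lambda>(t, x). h t x)" "t \<in> {0..T}" for t and h :: "real \<Rightarrow> real \<Rightarrow> real"
    by (rule continuous_on_subset[OF that(1)]) (use that(2) in auto)
  define r m where "r t = \<rho> t (\<phi> t)" and "m t = v t (\<phi> t)" for t
  have cr: "continuous_on {0..T} r" and cm: "continuous_on {0..T} m"
    unfolding r_def m_def by (rule continuous_on_along[OF c\<rho> c\<phi>], rule continuous_on_along[OF cv c\<phi>])
  have "((\<lambda>t. 0 - r t * m t) has_integral r t - r 0) {0..t}" if t: "t \<in> {0..T}" for t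
    unfolding r_def m_def
    by (rule transport_along_characteristic[where u = u and W = P and F = "\<lambda>t x. b t" and f = "\<lambda>t x. 0",
          OF _ sub[OF cv t] sub[OF c\<rho> t]])
       (use t in \<open>simp_all add: u_x P_x P_t \<phi>'\<close>)
  then have "(r has_real_derivative - (r t * m t)) (at t within {0..T})" if "t \<in> {0..T}" for t
    using integral_equation_imp_derivative[of T "\<lambda>t. 0 - r t * m t" r t] that cr cm
    by (simp add: continuous_on_minus continuous_on_mult)
  \<comment> \<open>The density vanishes along the whole characteristic, so it does not contribute to the equation for \<open>m\<close>.\<close>
  then have r0: "r t = 0" if "t \<in> {0..T}" for t
    using linear_ode_zero[OF cm _ _ that, of r] vac by (simp add: r_def \<phi>(1))
  have cf: "continuous_on ({0..T} \<times> UNIV) (\<lambda>(t, x). (\<rho> t x)\<^sup>2 / 2 + (v t x)\<^sup>2 / 2 + a)"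
    using cv c\<rho> unfolding case_prod_unfold by (intro continuous_intros) auto
  have "((\<lambda>t. ((r t)\<^sup>2 / 2 + (m t)\<^sup>2 / 2 + a) - m t * m t) has_integral m t - m 0) {0..t}" 
    if t: "t \<in> {0..T}" for t
    unfolding r_def m_def
    by (rule transport_along_characteristic[where u = u and W = u and F = F 
          and f = "\<lambda>t x. (\<rho> t x)\<^sup>2 / 2 + (v t x)\<^sup>2 / 2 + a",
          OF _ sub[OF cv t] sub[OF cv t] sub[OF cf t]])
       (use t in \<open>simp_all add: u_x F_x u_t \<phi>'\<close>)
  moreover have cm': "continuous_on {0..T} (\<lambda>t. ((r t)\<^sup>2 / 2 + (m t)\<^sup>2 / 2 + a) - m t * m t)"
    by (intro continuous_intros cr cm) simp_all
  ultimately have "(m has_real_derivative ((r t)\<^sup>2 / 2 + (m t)\<^sup>2 / 2 + a) - m t * m t) (at t within {0..T})" 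
    if "t \<in> {0..T}" for t
    using integral_equation_imp_derivative[of T "\<lambda>t. ((r t)\<^sup>2 / 2 + (m t)\<^sup>2 / 2 + a) - m t * m t" m t] that cm'
    by simp
  moreover have "((r t)\<^sup>2 / 2 + (m t)\<^sup>2 / 2 + a) - m t * m t = - ((m t)\<^sup>2 + c\<^sup>2) / 2" if "t \<in> {0..T}" for t
    using r0[OF that] c(2) by (simp add: power2_eq_square field_simps)
  ultimately have "(m has_real_derivative - ((m t)\<^sup>2 + c\<^sup>2) / 2) (at t within {0..T})" if "t \<in> {0..T}" for t
    using that by (metis (no_types, lifting))
  then show False using riccati_blowup[OF c(1), of T m] T by (simp add: c_def)
qed

text \<open>
  On an unbounded time interval the solution provides all data of the previous lemma, on an interval
  long enough for the Riccati solution to break down.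
\<close>
theorem theorem4p1:
  fixes h :: "real \<Rightarrow> real" and s :: real and u0 \<rho>0 :: "real \<Rightarrow> real"
    and T :: ereal and u \<rho> :: "real \<Rightarrow> real \<Rightarrow> real"
  assumes "continuous_on {0..} h"
    and "s \<ge> 2"
    and "u0 \<in> sobolev s" and "\<rho>0 \<in> sobolev (s - 1)"
    and "hs_maximal_solution 1 h s u0 \<rho>0 T u \<rho>"
    and "(\<exists>x. \<rho>0 x \<noteq> 0) \<or> \<not> (\<exists>c. \<forall>x. u0 x = c)"
    and "\<exists>x0. \<rho>0 x0 = 0"
  shows "T < \<infinity>"
proof (rule ccontr)
  assume "\<not> T < \<infinity>"
  then have I: "time_interval T = {0..}" by (auto simp: time_interval_def)
  define a where "a = hs_const 1 u0 \<rho>0"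
  have a: "a < 0" unfolding a_def using assms by (intro hs_const_neg)
  obtain x0 where x0: "\<rho>0 x0 = 0" using assms(7) by blast
  have "hs_solution 1 h s u0 \<rho>0 T u \<rho>" using assms(5) by (simp add: hs_maximal_solution_def)
  then obtain ut \<rho>t where C0: "sobolev_C0 {0..} s u" "sobolev_C0 {0..} (s - 1) \<rho>"
    and \<rho>0: "\<And>x. \<rho> 0 x = \<rho>0 x"
    and C1: "sobolev_C1 {0..} (s - 1) u ut" "sobolev_C1 {0..} (s - 2) \<rho> \<rho>t"
    and eq1: "\<And>t x. t > 0 \<Longrightarrow> ut t x + u t x * deriv (u t) x
         = inv_dx (\<lambda>y. 1 / 2 * (\<rho> t y)\<^sup>2 + 1 / 2 * (deriv (u t) y)\<^sup>2 + a) x + h t"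
    and eq2: "\<And>t. t > 0 \<Longrightarrow> \<exists>q. weak_deriv (\<lambda>x. \<rho> t x * u t x) q \<and> (AE x in lborel. \<rho>t t x + q x = 0)"
    unfolding hs_solution_def I a_def by auto
  have us: "u t \<in> sobolev s" and \<rho>s: "\<rho> t \<in> sobolev (s - 1)" if "t \<ge> 0" for t
    using C0 that by (auto simp: sobolev_C0_def)
  have per: "u t (x + 1) = u t x" "\<rho> t (x + 1) = \<rho> t x" and cont: "continuous_on UNIV (u t)" "continuous_on UNIV (\<rho> t)"
    if "t \<ge> 0" for t x
    using us[OF that] \<rho>s[OF that] assms(2) by (auto simp: sobolev_def periodic1_def)
  define v where "v t = deriv (u t)" for t
  have u_x: "(u t has_real_derivative v t x) (at x)" and cvt: "continuous_on UNIV (v t)" if "t \<ge> 0" for t x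
    unfolding v_def by (rule sobolev_imp_C1[OF assms(2) us[OF that]])+
  have v_per: "v t (x + 1) = v t x" if "t \<ge> 0" for t x
  proof -
    have "((\<lambda>x. u t (x + 1)) has_real_derivative v t (x + 1)) (at x)"
      using u_x[OF that, of "x + 1"] by (simp only: DERIV_shift)
    then have "(u t has_real_derivative v t (x + 1)) (at x)" using per(1)[OF that] by simp
    then show ?thesis using u_x[OF that] DERIV_unique by blast
  qed
  have cu: "continuous_on ({0..} \<times> UNIV) (\<lambda>(t, x). u t x)"
    using C0(1) assms(2) by (intro continuous_on_of_uniform_limit cont sobolev_C0_uniform_limit) auto
  have cv: "continuous_on ({0..} \<times> UNIV) (\<lambda>(t, x). v t x)"
    unfolding v_def using C0(1) assms(2) cvt[unfolded v_def]
    by (intro continuous_on_of_uniform_limit sobolev_C0_deriv_uniform_limit) auto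
  have c\<rho>: "continuous_on ({0..} \<times> UNIV) (\<lambda>(t, x). \<rho> t x)"
    using C0(2) assms(2) by (intro continuous_on_of_uniform_limit cont sobolev_C0_uniform_limit) auto
  have at: "at t within {0..} = at t" if "t > 0" for t :: real
    using that by (intro at_within_interior) (simp add: interior_real_atLeast)
  define F where "F t x = inv_dx (\<lambda>y. (\<rho> t y)\<^sup>2 / 2 + (v t y)\<^sup>2 / 2 + a) x + h t" for t x
  have F_x: "(F t has_real_derivative (\<rho> t x)\<^sup>2 / 2 + (v t x)\<^sup>2 / 2 + a) (at x)" if "t \<ge> 0" for t x
  proof -
    have "(inv_dx (\<lambda>y. (\<rho> t y)\<^sup>2 / 2 + (v t y)\<^sup>2 / 2 + a) has_real_derivative 
        (\<rho> t x)\<^sup>2 / 2 + (v t x)\<^sup>2 / 2 + a) (at x)"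
      by (rule inv_dx_has_derivative) (intro continuous_intros cont cvt that, simp_all)
    from DERIV_add[OF this DERIV_const] show ?thesis by (simp add: F_def[abs_def])
  qed
  have u_t: "((\<lambda>\<tau>. u \<tau> x) has_real_derivative F t x - u t x * v t x) (at t)" if "t > 0" for t x
  proof -
    have "((\<lambda>\<tau>. u \<tau> x) has_real_derivative ut t x) (at t within {0..})"
      by (rule sobolev_C1_pointwise_derivative[OF C1(1)]) (use that assms(2) in auto)
    moreover have "ut t x = F t x - u t x * v t x" using eq1[OF that, of x] by (simp add: F_def v_def)
    ultimately show ?thesis using at[OF that] by simp
  qed
  have coeff: "((\<lambda>t. fourier_coeff (\<rho> t) n) has_vector_derivative fourier_coeff (\<rho>t t) n) (at t within {0..})" 
    if "t \<ge> 0" for t n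
    by (rule sobolev_C1_coeff_derivative[OF C1(2)]) (use that assms(2) in auto)
  have coeff_eq: "fourier_coeff (\<rho>t t) n = - (2 * pi * of_int n * \<i> * fourier_coeff (\<lambda>x. \<rho> t x * u t x) n)"
    if "t > 0" for t n
  proof -
    obtain q where q: "weak_deriv (\<lambda>x. \<rho> t x * u t x) q" "AE x in lborel. \<rho>t t x + q x = 0"
      using eq2[OF \<open>t > 0\<close>] by blast
    have "\<rho>t t \<in> sobolev (s - 2)" using C1(2) that by (auto simp: sobolev_C1_def sobolev_C0_def)
    then have "fourier_coeff (\<rho>t t) n = - fourier_coeff q n"
      by (rule fourier_coeff_AE_opposite[OF set_integrable_sobolev _ q(2)])
         (use q(1) in \<open>simp add: weak_deriv_def\<close>)
    then show ?thesis using fourier_coeff_weak_deriv[OF q(1), of n] by simp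
  qed
  have P_t: "((\<lambda>\<tau>. inv_dx (\<rho> \<tau>) x) has_real_derivative \<rho> t 0 * u t 0 - u t x * \<rho> t x) (at t)" if "t > 0" for t x
  proof -
    have "((\<lambda>\<tau>. inv_dx (\<rho> \<tau>) x) has_real_derivative \<rho> t 0 * u t 0 - \<rho> t x * u t x) (at t)"
    proof (rule density_potential_derivative[OF c\<rho>, where g = "\<lambda>t x. \<rho> t x * u t x"])
      show "continuous_on ({0..} \<times> UNIV) (\<lambda>(t, x). \<rho> t x * u t x)"
        using c\<rho> cu unfolding case_prod_unfold by (rule continuous_on_mult)
      show "continuous_on {0..} (\<lambda>t. fourier_coeff (\<rho> t) n)" for n
        by (rule continuous_on_vector_derivative[OF coeff]) simp
      show "((\<lambda>t. fourier_coeff (\<rho> t) n) has_vector_derivative 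
        - (2 * pi * of_int n * \<i> * fourier_coeff (\<lambda>x. \<rho> t x * u t x) n)) (at t)" if "t > 0" for n t
        using coeff[of t n] at[OF that] that unfolding coeff_eq[OF that] by simp
    qed (use that per in auto)
    then show ?thesis by (simp add: mult.commute)
  qed
  define S where "S = 2 * pi / sqrt (- 2 * a)"
  have sub: "continuous_on ({0..S} \<times> UNIV) (\<lambda>(t, x). g t x)" 
    if "continuous_on ({0..} \<times> UNIV) (\<lambda>(t, x). g t x)" for g :: "real \<Rightarrow> real \<Rightarrow> real"
    by (rule continuous_on_subset[OF that]) auto
  show False
    by (rule riccati_along_vacuum_characteristic[OF a S_def sub[OF cu] sub[OF cv] sub[OF c\<rho>],
          where F = F and P = "\<lambda>t. inv_dx (\<rho> t)" and b = "\<lambda>t. \<rho> t 0 * u t 0" and ?x0.0 = x0])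
       (simp_all add: v_per u_x F_x u_t P_t inv_dx_has_derivative cont \<rho>0 x0)
qed

end
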